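(* Let $V$ be a finite-dimensional real inner product space, $\Omega\subseteq V$ a full-dimensional lattice, and $\mathcal{W}\subseteq \mathrm{GL}(V)$ a finite group with $s(\Omega)=\Omega$ for all $s\in\mathcal{W}$. Let $f=\sum_{\mu\in\Omega} f_\mu\,\mathfrak{e}^\mu$ be a $\mathcal{W}$-invariant trigonometric polynomial with $f_\mu=\overline{f_{-\mu}}$. Let $d\in\mathbb{N}$ be such that $\mu\in\Omega_d+\Omega_d$ whenever $f_\mu\neq 0$, and assume $s(\Omega_d)=\Omega_d$ for all $s\in\mathcal{W}$. Let $\mathbf{T}$ be a unitary change of basis matrix, according to the isotypic decomposition of $\mathbb{C}^{\Omega_d}$, that block diagonalizes all matrices in $\mathrm{Toep}_d^{\mathcal{W}}$ (as specified in the context), and assume that $\mathbf{T}^\dagger\,\mathbf{mat}(f)\,\mathbf{T}$ has blocks $\tilde{\mathbf{F}}_i\in\mathbb{C}^{m_i\times m_i}$, $1\le i\le h$. Define $$f_d:=\min_{\mathbf{X}\in\mathrm{Toep}_d}\ \mathrm{Trace}(\mathbf{mat}(f)\,\mathbf{X})\quad\text{s.t.}\quad \mathbf{X}\succeq 0,\ \mathrm{Trace}(\mathbf{X})=1,$$ $$f_{d,\mathcal{W}}:=\min_{\mathbf{X}\in\mathrm{Toep}_d^{\mathcal{W}}}\ \mathrm{Trace}(\mathbf{mat}(f)\,\mathbf{X})\quad\text{s.t.}\quad \mathbf{X}\succeq 0,\ \mathrm{Trace}(\mathbf{X})=1,$$ $$f_{d,\mathcal{W}}^{\mathrm{block}}:=\min_{\mathbf{X}\in\mathrm{Toep}_d^{\mathcal{W}}}\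 \sum_{i=1}^h d_i\,\mathrm{Trace}(\tilde{\mathbf{F}}_i\,\tilde{\mathbf{X}}_i)\quad\text{s.t.}\quad \mathrm{Trace}(\mathbf{X})=1,\ \mathbf{T}^\dagger\,\mathbf{X}\,\mathbf{T}\ \text{has blocks}\ \tilde{\mathbf{X}}_i\succeq 0.$$ Then $f_d=f_{d,\mathcal{W}}=f_{d,\mathcal{W}}^{\mathrm{block}}$.
   Context: Let $\langle\cdot,\cdot\rangle$ be the inner product on $V$ with norm $\|u\|=\sqrt{\langle u,u\rangle}$. The dual lattice of $\Omega$ is $\Lambda=\{\lambda\in V \mid \langle\mu,\lambda\rangle\in\mathbb{Z}\ \text{for all}\ \mu\in\Omega\}$. The Voronoi cell of $\Lambda$ is $\mathrm{Vor}(\Lambda)=\{u\in V\mid \|u\|\le\|u-\lambda\|\ \text{for all}\ \lambda\in\Lambda\}$. For $d\in\mathbb{N}=\{0,1,2,\ldots\}$, $\Omega_d:=\Omega\cap d\,\mathrm{Vor}(\Lambda)$, which is a finite set. For $\mu\in\Omega$ and $u\in V$, $\mathfrak{e}^\mu(u):=\exp(-2\pi \mathrm{i}\langle\mu,u\rangle)$. A trigonometric polynomial is a function $f:V\to\mathbb{R}$, $f=\sum_{\mu\in\Omega}f_\mu\,\mathfrak{e}^\mu$ with $f_\mu=\overline{f_{-\mu}}\in\mathbb{C}$, all but finitely many $f_\mu$ being zero. A group element $s\in\mathcal{W}$ acts by $s\cdot f=\sum_{\mu}f_\mu\,\mathfrak{e}^{s(\mu)}$; $f$ is $\mathcal{W}$-invariant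 if $s\cdot f=f$ for all $s\in\mathcal{W}$. $\mathrm{Toep}_d$ denotes the real vector space of Hermitian matrices $\mathbf{X}$ with complex entries $\mathbf{X}_{\mu\nu}$, rows and columns indexed by $\Omega_d$, that are Toeplitz, meaning that $\mathbf{X}_{\mu\nu}$ depends only on $\mu-\nu$. Let $\mathbf{E}_d(u)$ be the column vector with entries $\mathfrak{e}^\mu(u)/\sqrt{|\Omega_d|}$, $\mu\in\Omega_d$. If $\mu\in\Omega_d+\Omega_d$ whenever $f_\mu\ne0$, then $\mathbf{mat}(f)$ denotes the unique matrix in $\mathrm{Toep}_d$ with $f(u)=\mathbf{E}_d(u)^\dagger\,\mathbf{mat}(f)\,\mathbf{E}_d(u)$ for all $u\in V$, where $\dagger$ is the conjugate transpose. $\mathcal{W}$ acts on $\mathrm{Toep}_d$ by $(s\star\mathbf{X})_{\mu\nu}:=\mathbf{X}_{s^{-1}(\mu)\,s^{-1}(\nu)}$, and $\mathrm{Toep}_d^{\mathcal{W}}:=\{\mathbf{X}\in\mathrm{Toep}_d\mid s\star\mathbf{X}=\mathbf{X}\ \text{for all}\ s\in\mathcal{W}\}$. For $f$ $\mathcal{W}$-invariant, $\mathbf{mat}(f)\in\mathrm{Toep}_d^{\mathcal{W}}$. $\mathbf{X}\succeq0$ means that $\mathbf{X}$ is Hermitian positive semi-definite. $\mathbb{C}^{\Omega_d}$ is the space of complex vectors indexed by $\Omega_d$, a $\mathcal{W}$-module via the permutation representation $(\vartheta(s)\mathbf{x})_\mu:=\mathbf{x}_{s^{-1}(\mu)}$.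 It has an isotypic decomposition $\mathbb{C}^{\Omega_d}=\bigoplus_{i=1}^h\bigoplus_{j=1}^{m_i}V_{i\,j}$, where for each $i$ the $V_{i\,1},\ldots,V_{i\,m_i}$ are isomorphic simple $\mathcal{W}$-submodules of dimension $d_i$ (for distinct $i$ they are non-isomorphic) and $m_i$ is the multiplicity, so $\sum_i d_i m_i=|\Omega_d|$. According to this decomposition there is a unitary matrix $\mathbf{T}\in\mathrm{GL}(\mathbb{C}^{\Omega_d})$ (whose columns form a symmetry adapted basis) such that for every $\mathbf{X}\in\mathrm{Toep}_d^{\mathcal{W}}$ the matrix $\mathbf{T}^\dagger\mathbf{X}\mathbf{T}$ is block diagonal with diagonal blocks $\mathbf{X}_1,\ldots,\mathbf{X}_h$, $\mathbf{X}_i\in\mathbb{C}^{d_im_i\times d_im_i}$, and each $\mathbf{X}_i$ is itself block diagonal with $d_i$ equal diagonal blocks $\tilde{\mathbf{X}}_i\in\mathbb{C}^{m_i\times m_i}$. "$\mathbf{T}^\dagger\mathbf{X}\mathbf{T}$ has blocks $\tilde{\mathbf{X}}_i$" refers to these matrices, and $\tilde{\mathbf{F}}_i$ are the corresponding blocks for $\mathbf{X}=\mathbf{mat}(f)$. *)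

theory Defs
  imports "HOL-Analysis.Analysis" "HOL-Library.Function_Algebras"
begin

text \<open>
  The ambient space \<open>V\<close> is a type of class \<^class>\<open>real_inner\<close>. It is finite-dimensional as soon as it
  carries a full-dimensional lattice in the sense of the next definition, since the lattice basis
  is a finite basis of \<open>V\<close>. (The class \<open>euclidean_space\<close> would exclude \<open>V = {0}\<close>.)
\<close>

definition full_lattice :: "'a::real_inner set \<Rightarrow> bool" where
  "full_lattice \<Omega> \<longleftrightarrow> (\<exists>B. finite B \<and> independent B \<and> span B = UNIV \<and>
     \<Omega> = {\<Sum>b\<in>B. of_int (z b) *\<^sub>R b | z :: 'a \<Rightarrow> int. True})"

definition finite_linear_group :: "('a::real_vector \<Rightarrow> 'a) set \<Rightarrow> bool" where
  "finite_linear_group W \<longleftrightarrow> finite W \<and> (\<forall>s\<in>W. linear s \<and> bij s) \<and>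
     id \<in> W \<and> (\<forall>s\<in>W. \<forall>t\<in>W. s \<circ> t \<in> W) \<and> (\<forall>s\<in>W. inv s \<in> W)"

definition dual_lattice :: "'a::real_inner set \<Rightarrow> 'a set" where
  "dual_lattice \<Omega> = {l. \<forall>\<mu>\<in>\<Omega>. \<mu> \<bullet> l \<in> \<int>}"

definition Vor :: "'a::real_inner set \<Rightarrow> 'a set" where
  "Vor \<Lambda> = {u. \<forall>l\<in>\<Lambda>. norm u \<le> norm (u - l)}"

definition Omega_d :: "'a::real_inner set \<Rightarrow> nat \<Rightarrow> 'a set" where
  "Omega_d \<Omega> d = \<Omega> \<inter> (\<lambda>u. real d *\<^sub>R u) ` Vor (dual_lattice \<Omega>)"


section \<open>Trigonometric polynomials\<close>

definition chr :: "'a::real_inner \<Rightarrow> 'a \<Rightarrow> complex" where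
  "chr \<mu> u = exp (- 2 * of_real pi * \<i> * of_real (\<mu> \<bullet> u))"

text \<open>\<open>trig_poly \<Omega> c f\<close>: the real-valued function \<open>f\<close> is a trigonometric polynomial with
  coefficients \<open>f\<^sub>\<mu> = c \<mu>\<close>.\<close>

definition trig_poly :: "'a::real_inner set \<Rightarrow> ('a \<Rightarrow> complex) \<Rightarrow> ('a \<Rightarrow> real) \<Rightarrow> bool" where
  "trig_poly \<Omega> c f \<longleftrightarrow> {\<mu>. c \<mu> \<noteq> 0} \<subseteq> \<Omega> \<and> finite {\<mu>. c \<mu> \<noteq> 0} \<and>
     (\<forall>\<mu>\<in>\<Omega>. c \<mu> = cnj (c (- \<mu>))) \<and>
     (\<forall>u. complex_of_real (f u) = (\<Sum>\<mu> | c \<mu> \<noteq> 0. c \<mu> * chr \<mu> u))"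

definition tp_act :: "('a::real_inner \<Rightarrow> 'a) \<Rightarrow> ('a \<Rightarrow> complex) \<Rightarrow> 'a \<Rightarrow> complex" where
  "tp_act s c u = (\<Sum>\<mu> | c \<mu> \<noteq> 0. c \<mu> * chr (s \<mu>) u)"

definition tp_invariant ::
    "('a::real_inner \<Rightarrow> 'a) set \<Rightarrow> ('a \<Rightarrow> complex) \<Rightarrow> ('a \<Rightarrow> real) \<Rightarrow> bool" where
  "tp_invariant W c f \<longleftrightarrow> (\<forall>s\<in>W. \<forall>u. tp_act s c u = complex_of_real (f u))"


section \<open>Matrices over finite index sets\<close>

text \<open>A complex matrix with rows indexed by \<open>I\<close> and columns indexed by \<open>J\<close> is a function
  of two arguments of which only the values on \<open>I \<times> J\<close> matter; the operations take the relevant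
  index sets as arguments.\<close>

definition mmul :: "'k set \<Rightarrow> ('i \<Rightarrow> 'k \<Rightarrow> complex) \<Rightarrow> ('k \<Rightarrow> 'j \<Rightarrow> complex) \<Rightarrow> 'i \<Rightarrow> 'j \<Rightarrow> complex" where
  "mmul K A B = (\<lambda>i j. \<Sum>k\<in>K. A i k * B k j)"

definition adj :: "('i \<Rightarrow> 'j \<Rightarrow> complex) \<Rightarrow> 'j \<Rightarrow> 'i \<Rightarrow> complex" where
  "adj A = (\<lambda>j i. cnj (A i j))"

definition tr :: "'i set \<Rightarrow> ('i \<Rightarrow> 'i \<Rightarrow> complex) \<Rightarrow> complex" where
  "tr I A = (\<Sum>i\<in>I. A i i)"

definition qform :: "'i set \<Rightarrow> ('i \<Rightarrow> 'i \<Rightarrow> complex) \<Rightarrow> ('i \<Rightarrow> complex) \<Rightarrow> complex" where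
  "qform I A x = (\<Sum>i\<in>I. \<Sum>j\<in>I. cnj (x i) * A i j * x j)"

definition hermitian :: "'i set \<Rightarrow> ('i \<Rightarrow> 'i \<Rightarrow> complex) \<Rightarrow> bool" where
  "hermitian I A \<longleftrightarrow> (\<forall>i\<in>I. \<forall>j\<in>I. A i j = cnj (A j i))"

text \<open>The quadratic form of a Hermitian matrix is real, so that comparing its real part
  with 0 is no restriction.\<close>

definition psd :: "'i set \<Rightarrow> ('i \<Rightarrow> 'i \<Rightarrow> complex) \<Rightarrow> bool" where
  "psd I A \<longleftrightarrow> hermitian I A \<and> (\<forall>x. 0 \<le> Re (qform I A x))"

definition unitary :: "'i set \<Rightarrow> 'j set \<Rightarrow> ('i \<Rightarrow> 'j \<Rightarrow> complex) \<Rightarrow> bool" where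
  "unitary I J T \<longleftrightarrow>
     (\<forall>j\<in>J. \<forall>j'\<in>J. mmul I (adj T) T j j' = (if j = j' then 1 else 0)) \<and>
     (\<forall>i\<in>I. \<forall>i'\<in>I. mmul J T (adj T) i i' = (if i = i' then 1 else 0))"


section \<open>Toeplitz matrices\<close>

text \<open>Matrices are normalised to vanish outside \<open>\<Omega>\<^sub>d \<times> \<Omega>\<^sub>d\<close>, so that equality of functions
  is equality of matrices; \<open>mat_of\<close> and \<open>Toep_inv\<close> rely on this.\<close>

definition Toep :: "'a::real_inner set \<Rightarrow> nat \<Rightarrow> ('a \<Rightarrow> 'a \<Rightarrow> complex) set" where
  "Toep \<Omega> d = {X. (\<forall>\<mu> \<nu>. \<mu> \<notin> Omega_d \<Omega> d \<or> \<nu> \<notin> Omega_d \<Omega> d \<longrightarrow> X \<mu> \<nu> = 0) \<and>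
     hermitian (Omega_d \<Omega> d) X \<and>
     (\<forall>\<mu>\<in>Omega_d \<Omega> d. \<forall>\<nu>\<in>Omega_d \<Omega> d. \<forall>\<mu>'\<in>Omega_d \<Omega> d. \<forall>\<nu>'\<in>Omega_d \<Omega> d.
        \<mu> - \<nu> = \<mu>' - \<nu>' \<longrightarrow> X \<mu> \<nu> = X \<mu>' \<nu>')}"

definition E_vec :: "'a::real_inner set \<Rightarrow> nat \<Rightarrow> 'a \<Rightarrow> 'a \<Rightarrow> complex" where
  "E_vec \<Omega> d u = (\<lambda>\<mu>. chr \<mu> u / of_real (sqrt (real (card (Omega_d \<Omega> d)))))"

definition mat_of :: "'a::real_inner set \<Rightarrow> nat \<Rightarrow> ('a \<Rightarrow> real) \<Rightarrow> 'a \<Rightarrow> 'a \<Rightarrow> complex" where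
  "mat_of \<Omega> d f = (THE X. X \<in> Toep \<Omega> d \<and>
     (\<forall>u. complex_of_real (f u) = qform (Omega_d \<Omega> d) X (E_vec \<Omega> d u)))"

definition star_act :: "('a \<Rightarrow> 'a) \<Rightarrow> ('a \<Rightarrow> 'a \<Rightarrow> complex) \<Rightarrow> 'a \<Rightarrow> 'a \<Rightarrow> complex" where
  "star_act s X = (\<lambda>\<mu> \<nu>. X (inv s \<mu>) (inv s \<nu>))"

definition Toep_inv ::
    "'a::real_inner set \<Rightarrow> nat \<Rightarrow> ('a \<Rightarrow> 'a) set \<Rightarrow> ('a \<Rightarrow> 'a \<Rightarrow> complex) set" where
  "Toep_inv \<Omega> d W = {X \<in> Toep \<Omega> d. \<forall>s\<in>W. star_act s X = X}"


section \<open>The permutation representation and its isotypic decomposition\<close>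

definition cscale :: "complex \<Rightarrow> ('a \<Rightarrow> complex) \<Rightarrow> 'a \<Rightarrow> complex" where
  "cscale a x = (\<lambda>\<mu>. a * x \<mu>)"

interpretation cvec: vector_space cscale
  by unfold_locales (auto simp: cscale_def fun_eq_iff algebra_simps)

definition cspace :: "'a set \<Rightarrow> ('a \<Rightarrow> complex) set" where
  "cspace I = {x. \<forall>\<mu>. \<mu> \<notin> I \<longrightarrow> x \<mu> = 0}"

definition perm_rep :: "('a \<Rightarrow> 'a) \<Rightarrow> ('a \<Rightarrow> complex) \<Rightarrow> 'a \<Rightarrow> complex" where
  "perm_rep s x = (\<lambda>\<mu>. x (inv s \<mu>))"

definition submodule_of :: "'a set \<Rightarrow> ('a \<Rightarrow> 'a) set \<Rightarrow> ('a \<Rightarrow> complex) set \<Rightarrow> bool" where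
  "submodule_of I W U \<longleftrightarrow> cvec.subspace U \<and> U \<subseteq> cspace I \<and> (\<forall>s\<in>W. perm_rep s ` U \<subseteq> U)"

definition simple_submodule :: "'a set \<Rightarrow> ('a \<Rightarrow> 'a) set \<Rightarrow> ('a \<Rightarrow> complex) set \<Rightarrow> bool" where
  "simple_submodule I W U \<longleftrightarrow> submodule_of I W U \<and> U \<noteq> {0} \<and>
     (\<forall>U'. submodule_of I W U' \<and> U' \<subseteq> U \<longrightarrow> U' = {0} \<or> U' = U)"

definition module_iso ::
    "('a \<Rightarrow> 'a) set \<Rightarrow> ('a \<Rightarrow> complex) set \<Rightarrow> ('a \<Rightarrow> complex) set \<Rightarrow> bool" where
  "module_iso W U U' \<longleftrightarrow> (\<exists>\<phi>. bij_betw \<phi> U U' \<and>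
     (\<forall>x\<in>U. \<forall>y\<in>U. \<phi> (x + y) = \<phi> x + \<phi> y) \<and>
     (\<forall>a. \<forall>x\<in>U. \<phi> (cscale a x) = cscale a (\<phi> x)) \<and>
     (\<forall>s\<in>W. \<forall>x\<in>U. \<phi> (perm_rep s x) = perm_rep s (\<phi> x)))"

text \<open>The sums below are pointwise sums of functions; \<open>dd i\<close> is the dimension \<open>d\<^sub>i\<close>.\<close>

definition isotypic_decomposition ::
    "'a set \<Rightarrow> ('a \<Rightarrow> 'a) set \<Rightarrow> nat \<Rightarrow> (nat \<Rightarrow> nat) \<Rightarrow> (nat \<Rightarrow> nat) \<Rightarrow>
     (nat \<Rightarrow> nat \<Rightarrow> ('a \<Rightarrow> complex) set) \<Rightarrow> bool" where
  "isotypic_decomposition I W h m dd V \<longleftrightarrow>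
     (\<forall>i\<in>{1..h}. 1 \<le> m i) \<and>
     (\<forall>i\<in>{1..h}. \<forall>j\<in>{1..m i}. simple_submodule I W (V i j) \<and> cvec.dim (V i j) = dd i) \<and>
     (\<forall>i\<in>{1..h}. \<forall>j\<in>{1..m i}. \<forall>i'\<in>{1..h}. \<forall>j'\<in>{1..m i'}.
        module_iso W (V i j) (V i' j') \<longleftrightarrow> i = i') \<and>
     (\<forall>x\<in>cspace I. \<exists>!v. v \<in> (\<Pi>\<^sub>E (i, j)\<in>(SIGMA i:{1..h}. {1..m i}). V i j) \<and>
        x = (\<Sum>p\<in>(SIGMA i:{1..h}. {1..m i}). v p))"

text \<open>The columns of \<open>T\<close> are indexed by triples \<open>(i, k, j)\<close>, in this (lexicographic) order, where
  \<open>(i, j)\<close> refers to the summand \<open>V i j\<close> and \<open>k\<close> numbers a basis of that summand. With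
  \<open>i\<close> fixed, each \<open>k\<close> therefore corresponds to a contiguous diagonal block of size \<open>m i\<close>.\<close>

definition col_index :: "nat \<Rightarrow> (nat \<Rightarrow> nat) \<Rightarrow> (nat \<Rightarrow> nat) \<Rightarrow> (nat \<times> nat \<times> nat) set" where
  "col_index h m dd = (SIGMA i:{1..h}. {1..dd i} \<times> {1..m i})"

text \<open>As \<open>V i j\<close> has dimension \<open>dd i\<close>, the \<open>dd i\<close> columns spanning it form a basis.\<close>

definition adapted_basis ::
    "nat \<Rightarrow> (nat \<Rightarrow> nat) \<Rightarrow> (nat \<Rightarrow> nat) \<Rightarrow> (nat \<Rightarrow> nat \<Rightarrow> ('a \<Rightarrow> complex) set) \<Rightarrow>
     ('a \<Rightarrow> nat \<times> nat \<times> nat \<Rightarrow> complex) \<Rightarrow> bool" where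
  "adapted_basis h m dd V T \<longleftrightarrow> (\<forall>i\<in>{1..h}. \<forall>j\<in>{1..m i}.
     cvec.span {(\<lambda>\<mu>. T \<mu> (i, k, j)) | k. k \<in> {1..dd i}} = V i j)"

text \<open>\<open>has_blocks I h m dd T X B\<close>: \<open>T\<^sup>\<dagger> X T\<close> is block diagonal, the \<open>i\<close>-th block being itself
  block diagonal with \<open>dd i\<close> diagonal blocks all equal to \<open>B i\<close>, which has size \<open>m i\<close>.\<close>

definition has_blocks ::
    "'a set \<Rightarrow> nat \<Rightarrow> (nat \<Rightarrow> nat) \<Rightarrow> (nat \<Rightarrow> nat) \<Rightarrow> ('a \<Rightarrow> nat \<times> nat \<times> nat \<Rightarrow> complex) \<Rightarrow>
     ('a \<Rightarrow> 'a \<Rightarrow> complex) \<Rightarrow> (nat \<Rightarrow> nat \<Rightarrow> nat \<Rightarrow> complex) \<Rightarrow> bool" where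
  "has_blocks I h m dd T X B \<longleftrightarrow>
     (\<forall>(i, k, j)\<in>col_index h m dd. \<forall>(i', k', j')\<in>col_index h m dd.
        mmul I (mmul I (adj T) X) T (i, k, j) (i', k', j') =
          (if i = i' \<and> k = k' then B i j j' else 0))"


section \<open>The optimization problems\<close>

text \<open>Each set collects the objective values at the feasible points. The traces involved are
  those of products of two Hermitian matrices, hence real (see \<open>tr_mmul_hermitian_real\<close>); \<open>Re\<close> only
  changes the type.\<close>

lemma tr_mmul_hermitian_real:
  assumes "hermitian I A" "hermitian I B"
  shows "tr I (mmul I A B) \<in> \<real>"
proof -
  have "cnj (tr I (mmul I A B)) = (\<Sum>i\<in>I. \<Sum>k\<in>I. cnj (A i k) * cnj (B k i))"
    unfolding tr_def mmul_def by (simp add: cnj_sum)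
  also have "\<dots> = (\<Sum>i\<in>I. \<Sum>k\<in>I. A k i * B i k)"
  proof (intro sum.cong refl)
    fix i k assume "i \<in> I" "k \<in> I"
    then have "A k i = cnj (A i k)" "B i k = cnj (B k i)"
      using assms unfolding hermitian_def by blast+
    then show "cnj (A i k) * cnj (B k i) = A k i * B i k"
      by (simp only:)
  qed
  also have "\<dots> = tr I (mmul I A B)"
    unfolding tr_def mmul_def by (subst sum.swap) simp
  finally show ?thesis
    by (simp add: Reals_cnj_iff)
qed

definition vals :: "'a::real_inner set \<Rightarrow> nat \<Rightarrow> ('a \<Rightarrow> real) \<Rightarrow> real set" where
  "vals \<Omega> d f = {Re (tr (Omega_d \<Omega> d) (mmul (Omega_d \<Omega> d) (mat_of \<Omega> d f) X)) | X.
     X \<in> Toep \<Omega> d \<and> psd (Omega_d \<Omega> d) X \<and> tr (Omega_d \<Omega> d) X = 1}"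

definition vals_inv ::
    "'a::real_inner set \<Rightarrow> nat \<Rightarrow> ('a \<Rightarrow> 'a) set \<Rightarrow> ('a \<Rightarrow> real) \<Rightarrow> real set" where
  "vals_inv \<Omega> d W f = {Re (tr (Omega_d \<Omega> d) (mmul (Omega_d \<Omega> d) (mat_of \<Omega> d f) X)) | X.
     X \<in> Toep_inv \<Omega> d W \<and> psd (Omega_d \<Omega> d) X \<and> tr (Omega_d \<Omega> d) X = 1}"

definition vals_block ::
    "'a::real_inner set \<Rightarrow> nat \<Rightarrow> ('a \<Rightarrow> 'a) set \<Rightarrow> nat \<Rightarrow> (nat \<Rightarrow> nat) \<Rightarrow> (nat \<Rightarrow> nat) \<Rightarrow>
     ('a \<Rightarrow> nat \<times> nat \<times> nat \<Rightarrow> complex) \<Rightarrow> (nat \<Rightarrow> nat \<Rightarrow> nat \<Rightarrow> complex) \<Rightarrow> real set" where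
  "vals_block \<Omega> d W h m dd T F =
     {Re (\<Sum>i=1..h. of_nat (dd i) * tr {1..m i} (mmul {1..m i} (F i) (B i))) | X B.
        X \<in> Toep_inv \<Omega> d W \<and> tr (Omega_d \<Omega> d) X = 1 \<and>
        has_blocks (Omega_d \<Omega> d) h m dd T X B \<and> (\<forall>i\<in>{1..h}. psd {1..m i} (B i))}"

definition has_min :: "real set \<Rightarrow> bool" where
  "has_min S \<longleftrightarrow> (\<exists>r\<in>S. \<forall>r'\<in>S. r \<le> r')"

text \<open>The following are the minima of the three problems, and are meaningful
  only if the minima are attained, i.e. together with \<^const>\<open>has_min\<close>.\<close>

definition f_d :: "'a::real_inner set \<Rightarrow> nat \<Rightarrow> ('a \<Rightarrow> real) \<Rightarrow> real" where
  "f_d \<Omega> d f = (LEAST r. r \<in> vals \<Omega> d f)"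

definition f_d_inv :: "'a::real_inner set \<Rightarrow> nat \<Rightarrow> ('a \<Rightarrow> 'a) set \<Rightarrow> ('a \<Rightarrow> real) \<Rightarrow> real" where
  "f_d_inv \<Omega> d W f = (LEAST r. r \<in> vals_inv \<Omega> d W f)"

definition f_d_block ::
    "'a::real_inner set \<Rightarrow> nat \<Rightarrow> ('a \<Rightarrow> 'a) set \<Rightarrow> nat \<Rightarrow> (nat \<Rightarrow> nat) \<Rightarrow> (nat \<Rightarrow> nat) \<Rightarrow>
     ('a \<Rightarrow> nat \<times> nat \<times> nat \<Rightarrow> complex) \<Rightarrow> (nat \<Rightarrow> nat \<Rightarrow> nat \<Rightarrow> complex) \<Rightarrow> real" where
  "f_d_block \<Omega> d W h m dd T F = (LEAST r. r \<in> vals_block \<Omega> d W h m dd T F)"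

end

theory Submission
  imports Defs
begin

text \<open>
  The three optimization problems have the same set of objective values, so their minima coincide
  as soon as one of them is attained.

  A Toeplitz matrix \<open>X\<close> satisfies \<open>E(u)\<^sup>\<dagger> X E(u) = (1/N) \<Sum>\<^sub>\<mu> \<Sum>\<^sub>\<nu> X \<mu> \<nu> chr (\<nu> - \<mu>) u\<close>, where \<open>N\<close> is the
  number of indices. The characters \<open>chr \<delta>\<close> are linearly independent (\<open>chr_independent\<close>, Dedekind's
  argument). Hence the matrix of a trigonometric polynomial exists, is unique, and is given by
  spreading the coefficients evenly over the diagonals (\<open>mat_of_eq_coeff_matrix\<close>). By the same
  independence an invariant polynomial has invariant coefficients, and therefore an invariant
  matrix (\<open>mat_of_invariant\<close>).

  Averaging a feasible matrix over the group gives an invariant feasible matrix, with the same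
  objective value because the cost matrix is invariant; so the restriction to invariant matrices
  does not change the set of values (\<open>vals_eq_vals_inv\<close>).

  Conjugation by the unitary matrix \<open>T\<close> preserves the trace of products and positive
  semidefiniteness, and both can be read off from the blocks: the block \<open>i\<close> appears \<open>dd i\<close>
  times, which accounts for the weights in the third problem, and \<open>dd i \<ge> 1\<close>, so that every block
  does appear (\<open>vals_inv_eq_vals_block\<close>).

  The minimum is attained (\<open>has_min_vals\<close>) because the feasible set of the first problem is closed
  and the entries of a positive semidefinite matrix of trace 1 are bounded by 1. This uses that the
  index set is finite (\<open>finite_Omega_d\<close>): on the Voronoi cell of the dual lattice the coordinates
  with respect to a basis of the lattice are bounded.
\<close>

section \<open>Finiteness and symmetry of the index set\<close>

lemma dual_vector_exists:
  fixes B :: "'a::real_inner set"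
  assumes "finite B" "independent B" "b \<in> B"
  shows "\<exists>w. b \<bullet> w = 1 \<and> (\<forall>b'\<in>B - {b}. b' \<bullet> w = 0)"
proof -
  obtain C where C: "finite C" "span C = span (B - {b})" "pairwise orthogonal C"
    using basis_orthogonal[of "B - {b}"] assms(1) by auto
  define p where "p = (\<Sum>c\<in>C. ((c \<bullet> b) / (c \<bullet> c)) *\<^sub>R c)"
  define w where "w = b - p"
  have "p \<in> span (B - {b})"
    unfolding p_def C(2)[symmetric] by (intro span_sum span_scale span_base)
  have orth_C: "c \<bullet> w = 0" if "c \<in> C" for c
  proof -
    have "c \<bullet> p = (\<Sum>c'\<in>C. if c' = c then c \<bullet> b else 0)"
      unfolding p_def inner_sum_right
      using C(3) that by (intro sum.cong) (auto simp: pairwise_def orthogonal_def)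
    then show ?thesis
      using that C(1) by (simp add: w_def inner_diff_right)
  qed
  have orth: "x \<bullet> w = 0" if "x \<in> span (B - {b})" for x
    using that unfolding C(2)[symmetric]
    by (induction rule: span_induct) (auto simp: subspace_def inner_add_left orth_C)
  have "b \<notin> span (B - {b})"
    using assms(2,3) by (meson dependent_def)
  with \<open>p \<in> _\<close> have "w \<noteq> 0"
    by (auto simp: w_def)
  moreover have "b \<bullet> w = w \<bullet> w"
    using orth[OF \<open>p \<in> _\<close>] by (simp add: w_def inner_diff_left)
  ultimately show ?thesis
    using orth by (intro exI[of _ "(1 / (w \<bullet> w)) *\<^sub>R w"]) (auto intro: span_base)
qed

lemma uminus_lattice:
  assumes "full_lattice \<Omega>" "\<mu> \<in> \<Omega>"
  shows "- \<mu> \<in> \<Omega>"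
proof -
  obtain B z where "\<Omega> = {\<Sum>b\<in>B. of_int (z b) *\<^sub>R b | z :: 'a \<Rightarrow> int. True}"
    and "\<mu> = (\<Sum>b\<in>B. of_int (z b) *\<^sub>R b)"
    using assms unfolding full_lattice_def by blast
  then show ?thesis
    by (auto intro!: exI[of _ "\<lambda>b. - z b"] simp: sum_negf)
qed

lemma uminus_dual_lattice: "l \<in> dual_lattice \<Omega> \<Longrightarrow> - l \<in> dual_lattice \<Omega>"
  by (auto simp: dual_lattice_def)

lemma uminus_Vor_dual_lattice:
  assumes "u \<in> Vor (dual_lattice \<Omega>)"
  shows "- u \<in> Vor (dual_lattice \<Omega>)"
  unfolding Vor_def
proof safe
  fix l assume "l \<in> dual_lattice \<Omega>"
  then have "norm u \<le> norm (u - - l)"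
    using assms uminus_dual_lattice unfolding Vor_def by blast
  then show "norm (- u) \<le> norm (- u - l)"
    using norm_minus_cancel[of "u + l"] by simp
qed

text \<open>Membership in the Voronoi cell bounds the inner products with the points of the lattice.\<close>

lemma Vor_dual_lattice_inner_le:
  assumes "u \<in> Vor (dual_lattice \<Omega>)" "l \<in> dual_lattice \<Omega>"
  shows "\<bar>u \<bullet> l\<bar> \<le> (l \<bullet> l) / 2"
proof -
  have "u \<bullet> l' \<le> (l' \<bullet> l') / 2" if "l' \<in> dual_lattice \<Omega>" for l'
  proof -
    have "norm u \<le> norm (u - l')"
      using assms(1) that by (auto simp: Vor_def)
    then have "u \<bullet> u \<le> (u - l') \<bullet> (u - l')"
      by (simp add: norm_le)
    then show ?thesis
      by (simp add: inner_diff_left inner_diff_right inner_commute)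
  qed
  from this[OF assms(2)] this[OF uminus_dual_lattice[OF assms(2)]] show ?thesis
    by auto
qed

lemma zero_in_Omega_d:
  assumes "full_lattice \<Omega>"
  shows "0 \<in> Omega_d \<Omega> d"
proof -
  have "0 \<in> \<Omega>"
    using assms unfolding full_lattice_def by (auto intro!: exI[of _ "\<lambda>_. 0"])
  moreover have "0 \<in> Vor (dual_lattice \<Omega>)"
    by (simp add: Vor_def)
  ultimately show ?thesis
    by (force simp: Omega_d_def)
qed

lemma uminus_Omega_d:
  assumes "full_lattice \<Omega>" "\<mu> \<in> Omega_d \<Omega> d"
  shows "- \<mu> \<in> Omega_d \<Omega> d"
proof -
  obtain u where u: "\<mu> \<in> \<Omega>" "\<mu> = real d *\<^sub>R u" "u \<in> Vor (dual_lattice \<Omega>)"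
    using assms(2) by (auto simp: Omega_d_def)
  have "- \<mu> \<in> \<Omega>"
    using uminus_lattice[OF assms(1) u(1)] .
  moreover have "- \<mu> = real d *\<^sub>R (- u)"
    by (simp add: u(2))
  ultimately show ?thesis
    using uminus_Vor_dual_lattice[OF u(3)] unfolding Omega_d_def by blast
qed

text \<open>The coordinates of a lattice point with respect to a lattice basis are its inner products
  with the dual basis, which consists of dual lattice points; on \<open>d Vor \<Lambda>\<close> they are bounded.\<close>

lemma finite_Omega_d:
  fixes \<Omega> :: "'a::real_inner set"
  assumes "full_lattice \<Omega>"
  shows "finite (Omega_d \<Omega> d)"
proof -
  obtain B where B: "finite B" "independent B"
    and \<Omega>: "\<Omega> = {\<Sum>b\<in>B. of_int (z b) *\<^sub>R b | z :: 'a \<Rightarrow> int. True}"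
    using assms unfolding full_lattice_def by blast
  obtain w where w: "b \<in> B \<Longrightarrow> b \<bullet> w b = 1"
      "b \<in> B \<Longrightarrow> b' \<in> B \<Longrightarrow> b' \<noteq> b \<Longrightarrow> b' \<bullet> w b = 0" for b b'
    using dual_vector_exists[OF B] by (metis DiffI singletonD)
  have coord: "(\<Sum>b'\<in>B. of_int (z b') *\<^sub>R b') \<bullet> w b = of_int (z b)" if "b \<in> B" for z b
  proof -
    have "(\<Sum>b'\<in>B. of_int (z b') *\<^sub>R b') \<bullet> w b = (\<Sum>b'\<in>B. if b' = b then of_int (z b) else 0)"
      unfolding inner_sum_left using that by (intro sum.cong) (auto simp: w)
    then show ?thesis
      using that B(1) by simp
  qed
  have dual: "w b \<in> dual_lattice \<Omega>" if "b \<in> B" for b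
    using that by (auto simp: dual_lattice_def \<Omega> coord)
  define K where "K b = \<lceil>real d * ((w b \<bullet> w b) / 2)\<rceil>" for b
  have "Omega_d \<Omega> d \<subseteq> (\<lambda>z. \<Sum>b\<in>B. of_int (z b) *\<^sub>R b) ` (\<Pi>\<^sub>E b\<in>B. {- K b..K b})"
  proof
    fix \<mu> assume "\<mu> \<in> Omega_d \<Omega> d"
    then obtain z u where z: "\<mu> = (\<Sum>b\<in>B. of_int (z b) *\<^sub>R b)"
      and u: "\<mu> = real d *\<^sub>R u" "u \<in> Vor (dual_lattice \<Omega>)"
      unfolding Omega_d_def \<Omega> by auto
    have "z b \<in> {- K b..K b}" if "b \<in> B" for b
    proof -
      have "real_of_int \<bar>z b\<bar> = real d * \<bar>u \<bullet> w b\<bar>"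
      proof -
        have "real_of_int (z b) = real d * (u \<bullet> w b)"
          using coord[OF that, of z] by (simp add: z[symmetric] u(1))
        then show ?thesis
          by (simp add: abs_mult)
      qed
      also have "\<dots> \<le> real d * ((w b \<bullet> w b) / 2)"
        using Vor_dual_lattice_inner_le[OF u(2) dual[OF that]] by (intro mult_left_mono) auto
      finally have "\<bar>z b\<bar> \<le> K b"
        unfolding K_def by linarith
      then show ?thesis
        by auto
    qed
    then have "restrict z B \<in> (\<Pi>\<^sub>E b\<in>B. {- K b..K b})"
      by auto
    moreover have "\<mu> = (\<Sum>b\<in>B. of_int (restrict z B b) *\<^sub>R b)"
      unfolding z by (intro sum.cong) auto
    ultimately show "\<mu> \<in> (\<lambda>z. \<Sum>b\<in>B. of_int (z b) *\<^sub>R b) ` (\<Pi>\<^sub>E b\<in>B. {- K b..K b})"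
      by blast
  qed
  then show ?thesis
    by (rule finite_subset) (use B(1) in \<open>auto intro!: finite_imageI finite_PiE\<close>)
qed

section \<open>Linear independence of the characters\<close>

lemma chr_add: "chr \<mu> (u + v) = chr \<mu> u * chr \<mu> v"
  by (simp add: chr_def inner_add_right algebra_simps flip: exp_add)

lemma chr_diff_index: "chr (\<nu> - \<mu>) u = cnj (chr \<mu> u) * chr \<nu> u"
  by (simp add: chr_def inner_diff_left algebra_simps exp_cnj flip: exp_add)

lemma chr_nonzero: "chr \<mu> u \<noteq> 0"
  by (simp add: chr_def)

lemma chr_separates:
  assumes "\<mu> \<noteq> \<nu>"
  shows "\<exists>v. chr \<mu> v \<noteq> chr \<nu> v"
proof -
  \<comment> \<open>This multiple of \<open>\<mu> - \<nu>\<close> makes the two values differ by the factor \<open>exp (- \<i> \<pi>) = - 1\<close>.\<close>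
  define v where "v = (1 / (2 * ((\<mu> - \<nu>) \<bullet> (\<mu> - \<nu>)))) *\<^sub>R (\<mu> - \<nu>)"
  have "(\<mu> - \<nu>) \<bullet> v = 1 / 2"
    using assms by (simp add: v_def)
  then have "chr (\<mu> - \<nu>) v = exp (- (\<i> * of_real pi))"
    by (simp only: chr_def) (simp add: mult.commute)
  then have "chr (\<mu> - \<nu>) v = - 1"
    by (simp add: exp_minus)
  moreover have "chr \<mu> v = chr (\<mu> - \<nu>) v * chr \<nu> v"
    by (simp add: chr_def inner_diff_left algebra_simps flip: exp_add)
  ultimately show ?thesis
    using chr_nonzero[of \<nu> v] by (intro exI[of _ v]) auto
qed

text \<open>Dedekind's argument for distinct characters of a group.\<close>

lemma chr_independent:
  assumes "finite S" "\<And>u. (\<Sum>\<mu>\<in>S. a \<mu> * chr \<mu> u) = 0" "\<nu> \<in> S"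
  shows "a \<nu> = 0"
  using assms
proof (induction S arbitrary: a \<nu> rule: finite_induct)
  case empty
  then show ?case by simp
next
  case (insert \<mu>\<^sub>0 S)
  have S: "a \<mu> = 0" if "\<mu> \<in> S" for \<mu>
  proof -
    have "\<mu> \<noteq> \<mu>\<^sub>0"
      using that insert.hyps by auto
    then obtain v where v: "chr \<mu> v \<noteq> chr \<mu>\<^sub>0 v"
      using chr_separates by blast
    \<comment> \<open>Translating the relation by \<open>v\<close> and subtracting \<open>chr \<mu>\<^sub>0 v\<close> times the original relation
      eliminates the term of \<open>\<mu>\<^sub>0\<close>.\<close>
    have "(\<Sum>\<mu>\<in>S. (a \<mu> * (chr \<mu> v - chr \<mu>\<^sub>0 v)) * chr \<mu> u) = 0" for u
    proof -
      have "(\<Sum>\<mu>\<in>S. (a \<mu> * (chr \<mu> v - chr \<mu>\<^sub>0 v)) * chr \<mu> u)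
          = (\<Sum>\<mu>\<in>insert \<mu>\<^sub>0 S. (a \<mu> * (chr \<mu> v - chr \<mu>\<^sub>0 v)) * chr \<mu> u)"
        using insert.hyps by simp
      also have "\<dots> = (\<Sum>\<mu>\<in>insert \<mu>\<^sub>0 S. a \<mu> * chr \<mu> (u + v))
          - chr \<mu>\<^sub>0 v * (\<Sum>\<mu>\<in>insert \<mu>\<^sub>0 S. a \<mu> * chr \<mu> u)"
        by (simp only: sum_distrib_left sum_subtractf[symmetric] chr_add) 
          (intro sum.cong refl, simp add: algebra_simps)
      finally show ?thesis
        using insert.prems(1) by simp
    qed
    from insert.IH[OF this that] v show ?thesis
      by simp
  qed
  have "a \<mu>\<^sub>0 * chr \<mu>\<^sub>0 0 = 0"
    using insert.prems(1)[of 0] insert.hyps S by simp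
  with S insert.prems(2) chr_nonzero show ?case
    by auto
qed

section \<open>The Toeplitz matrix of a trigonometric polynomial\<close>

text \<open>Invariance is a statement about the function; linear independence of the characters carries
  it over to the coefficients.\<close>

lemma invariant_coefficients:
  fixes W :: "('a::real_inner \<Rightarrow> 'a) set"
  assumes poly: "trig_poly \<Omega> c f" and inv: "tp_invariant W c f"
    and s: "s \<in> W" "bij s"
  shows "c (inv s \<mu>) = c \<mu>"
proof -
  define S where "S = {\<mu>. c \<mu> \<noteq> 0}"
  have fin: "finite S" and f: "complex_of_real (f u) = (\<Sum>\<mu>\<in>S. c \<mu> * chr \<mu> u)" for u
    using poly by (auto simp: trig_poly_def S_def)
  have invs: "inv s (s x) = x" "s (inv s x) = x" for x
    using s(2) by (auto simp: bij_is_inj bij_is_surj surj_f_inv_f)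
  have f': "complex_of_real (f u) = (\<Sum>\<mu>\<in>s ` S. c (inv s \<mu>) * chr \<mu> u)" for u
  proof -
    have "complex_of_real (f u) = (\<Sum>\<mu>\<in>S. c \<mu> * chr (s \<mu>) u)"
      using inv s(1) by (simp add: tp_invariant_def tp_act_def S_def)
    also have "\<dots> = (\<Sum>\<mu>\<in>s ` S. c (inv s \<mu>) * chr \<mu> u)"
      using s(2) by (subst sum.reindex) (auto simp: invs inj_on_def bij_def inj_def)
    finally show ?thesis .
  qed
  have out: "\<nu> \<notin> S \<Longrightarrow> c \<nu> = 0" "\<nu> \<notin> s ` S \<Longrightarrow> c (inv s \<nu>) = 0" for \<nu>
  proof -
    show "\<nu> \<notin> S \<Longrightarrow> c \<nu> = 0"
      by (simp add: S_def)
    show "c (inv s \<nu>) = 0" if "\<nu> \<notin> s ` S"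
      using that imageI[of "inv s \<nu>" S s] by (auto simp: invs S_def)
  qed
  have "(\<Sum>\<nu>\<in>S \<union> s ` S. (c (inv s \<nu>) - c \<nu>) * chr \<nu> u) = 0" for u
  proof -
    have "(\<Sum>\<nu>\<in>S \<union> s ` S. c \<nu> * chr \<nu> u) = complex_of_real (f u)"
      unfolding f using fin by (intro sum.mono_neutral_right) (auto simp: out)
    moreover have "(\<Sum>\<nu>\<in>S \<union> s ` S. c (inv s \<nu>) * chr \<nu> u) = complex_of_real (f u)"
      unfolding f' using fin by (intro sum.mono_neutral_right) (auto simp: out(2))
    ultimately show ?thesis
      by (simp add: left_diff_distrib sum_subtractf)
  qed
  from chr_independent[OF _ this] fin have "\<nu> \<in> S \<union> s ` S \<Longrightarrow> c (inv s \<nu>) = c \<nu>" for \<nu>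
    by (metis eq_iff_diff_eq_0 finite_Un finite_imageI)
  then show ?thesis
    using out[of \<mu>] by (cases "\<mu> \<in> S \<union> s ` S") auto
qed

text \<open>A diagonal of a Toeplitz matrix with index set \<open>I\<close>: the pairs (row, column) with a given
  difference. It is column minus row, the frequency of the product
  \<open>cnj (chr \<mu> u) * chr \<nu> u\<close> that occurs in the quadratic form.\<close>

definition diag_pairs :: "'a::ab_group_add set \<Rightarrow> 'a \<Rightarrow> ('a \<times> 'a) set" where
  "diag_pairs I \<delta> = {(\<mu>, \<nu>) \<in> I \<times> I. \<nu> - \<mu> = \<delta>}"

lemma finite_diag_pairs: "finite I \<Longrightarrow> finite (diag_pairs I \<delta>)"
  by (rule finite_subset[of _ "I \<times> I"]) (auto simp: diag_pairs_def)

lemma card_diag_pairs_uminus: "card (diag_pairs I (- \<delta>)) = card (diag_pairs I \<delta>)"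
proof (rule bij_betw_same_card)
  show "bij_betw prod.swap (diag_pairs I (- \<delta>)) (diag_pairs I \<delta>)"
    by (rule bij_betwI[where g = prod.swap]) (auto simp: diag_pairs_def algebra_simps)
qed

lemma card_diag_pairs_linear:
  assumes "linear s" "bij s" "s ` I = I"
  shows "card (diag_pairs I (s \<delta>)) = card (diag_pairs I \<delta>)"
proof (rule bij_betw_same_card[symmetric])
  have diff: "s y - s x = s (y - x)" for x y
    using linear_diff[OF assms(1)] by simp
  have invs: "inv s (s x) = x" "s (inv s x) = x" for x
    using assms(2) by (auto simp: bij_is_inj bij_is_surj surj_f_inv_f)
  have diff': "inv s y - inv s x = inv s (y - x)" for x y
    using diff[of "inv s y" "inv s x"] by (metis invs)
  have mem: "s x \<in> I" "inv s x \<in> I" if "x \<in> I" for x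
    using that assms(3) invs(1) by auto (metis imageE invs(1))
  show "bij_betw (map_prod s s) (diag_pairs I \<delta>) (diag_pairs I (s \<delta>))"
    by (rule bij_betwI[where g = "map_prod (inv s) (inv s)"])
      (auto simp: diag_pairs_def diff diff' invs mem)
qed

lemma sum_by_differences:
  fixes g :: "'a::ab_group_add \<Rightarrow> 'a \<Rightarrow> complex"
  assumes "finite I"
  shows "(\<Sum>\<mu>\<in>I. \<Sum>\<nu>\<in>I. g \<mu> \<nu>) =
    (\<Sum>\<delta>\<in>(\<lambda>(\<mu>, \<nu>). \<nu> - \<mu>) ` (I \<times> I). \<Sum>(\<mu>, \<nu>)\<in>diag_pairs I \<delta>. g \<mu> \<nu>)"
proof -
  have "(\<Sum>\<mu>\<in>I. \<Sum>\<nu>\<in>I. g \<mu> \<nu>) = (\<Sum>(\<mu>, \<nu>)\<in>I \<times> I. g \<mu> \<nu>)"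
    by (simp add: sum.cartesian_product)
  also have "\<dots> = (\<Sum>\<delta>\<in>(\<lambda>(\<mu>, \<nu>). \<nu> - \<mu>) ` (I \<times> I).
      sum (\<lambda>(\<mu>, \<nu>). g \<mu> \<nu>) {p \<in> I \<times> I. (\<lambda>(\<mu>, \<nu>). \<nu> - \<mu>) p = \<delta>})"
    by (rule sum.image_gen) (use assms in simp)
  also have "\<dots> = (\<Sum>\<delta>\<in>(\<lambda>(\<mu>, \<nu>). \<nu> - \<mu>) ` (I \<times> I). \<Sum>(\<mu>, \<nu>)\<in>diag_pairs I \<delta>. g \<mu> \<nu>)"
    by (intro sum.cong refl) (auto simp: diag_pairs_def)
  finally show ?thesis .
qed

lemma qform_E_vec:
  "qform (Omega_d \<Omega> d) X (E_vec \<Omega> d u) =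
    (\<Sum>\<mu>\<in>Omega_d \<Omega> d. \<Sum>\<nu>\<in>Omega_d \<Omega> d. X \<mu> \<nu> * chr (\<nu> - \<mu>) u) / of_nat (card (Omega_d \<Omega> d))"
proof -
  let ?N = "card (Omega_d \<Omega> d)"
  have "complex_of_real (sqrt (real ?N)) * complex_of_real (sqrt (real ?N)) = of_nat ?N"
    by (simp flip: of_real_mult)
  then have "cnj (E_vec \<Omega> d u \<mu>) * X \<mu> \<nu> * E_vec \<Omega> d u \<nu> =
      X \<mu> \<nu> * chr (\<nu> - \<mu>) u / of_nat ?N" for \<mu> \<nu>
    by (simp add: E_vec_def chr_diff_index)
  then show ?thesis
    by (simp add: qform_def sum_divide_distrib)
qed

lemma Toep_outside:
  "X \<in> Toep \<Omega> d \<Longrightarrow> \<mu> \<notin> Omega_d \<Omega> d \<or> \<nu> \<notin> Omega_d \<Omega> d \<Longrightarrow> X \<mu> \<nu> = 0"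
  unfolding Toep_def by blast

lemma Toep_hermitian: "X \<in> Toep \<Omega> d \<Longrightarrow> hermitian (Omega_d \<Omega> d) X"
  unfolding Toep_def by blast

lemma Toep_diagonal:
  assumes "X \<in> Toep \<Omega> d" "\<mu> \<in> Omega_d \<Omega> d" "\<nu> \<in> Omega_d \<Omega> d" "\<mu>' \<in> Omega_d \<Omega> d" "\<nu>' \<in> Omega_d \<Omega> d"
    and "\<mu> - \<nu> = \<mu>' - \<nu>'"
  shows "X \<mu> \<nu> = X \<mu>' \<nu>'"
  using assms(1)[unfolded Toep_def mem_Collect_eq, THEN conjunct2, THEN conjunct2] assms(2-)
  by blast

lemma ToepI:
  assumes "\<And>\<mu> \<nu>. \<mu> \<notin> Omega_d \<Omega> d \<or> \<nu> \<notin> Omega_d \<Omega> d \<Longrightarrow> X \<mu> \<nu> = 0"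
    and "hermitian (Omega_d \<Omega> d) X"
    and "\<And>\<mu> \<nu> \<mu>' \<nu>'. \<mu> \<in> Omega_d \<Omega> d \<Longrightarrow> \<nu> \<in> Omega_d \<Omega> d \<Longrightarrow> \<mu>' \<in> Omega_d \<Omega> d \<Longrightarrow>
      \<nu>' \<in> Omega_d \<Omega> d \<Longrightarrow> \<mu> - \<nu> = \<mu>' - \<nu>' \<Longrightarrow> X \<mu> \<nu> = X \<mu>' \<nu>'"
  shows "X \<in> Toep \<Omega> d"
  unfolding Toep_def mem_Collect_eq using assms by blast

text \<open>A Toeplitz matrix is determined by its quadratic form on the vectors \<^const>\<open>E_vec\<close>: the values
  on its diagonals are, up to nonzero factors, the coefficients of the characters in this form.\<close>

lemma Toep_unique:
  assumes fin: "finite (Omega_d \<Omega> d)" and XY: "X \<in> Toep \<Omega> d" "Y \<in> Toep \<Omega> d"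
    and eq: "\<And>u. qform (Omega_d \<Omega> d) X (E_vec \<Omega> d u) = qform (Omega_d \<Omega> d) Y (E_vec \<Omega> d u)"
  shows "X = Y"
proof (intro ext)
  fix \<mu>\<^sub>0 \<nu>\<^sub>0
  let ?I = "Omega_d \<Omega> d"
  define a where "a \<delta> = (\<Sum>(\<mu>, \<nu>)\<in>diag_pairs ?I \<delta>. X \<mu> \<nu> - Y \<mu> \<nu>)" for \<delta>
  show "X \<mu>\<^sub>0 \<nu>\<^sub>0 = Y \<mu>\<^sub>0 \<nu>\<^sub>0"
  proof (cases "\<mu>\<^sub>0 \<in> ?I \<and> \<nu>\<^sub>0 \<in> ?I")
    case True
    have card: "card ?I \<noteq> 0"
      using True fin by auto
    have "(\<Sum>\<delta>\<in>(\<lambda>(\<mu>, \<nu>). \<nu> - \<mu>) ` (?I \<times> ?I). a \<delta> * chr \<delta> u) = 0" for u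
    proof -
      have "(\<Sum>\<delta>\<in>(\<lambda>(\<mu>, \<nu>). \<nu> - \<mu>) ` (?I \<times> ?I). a \<delta> * chr \<delta> u) =
          (\<Sum>\<delta>\<in>(\<lambda>(\<mu>, \<nu>). \<nu> - \<mu>) ` (?I \<times> ?I).
            \<Sum>(\<mu>, \<nu>)\<in>diag_pairs ?I \<delta>. (X \<mu> \<nu> - Y \<mu> \<nu>) * chr (\<nu> - \<mu>) u)"
        unfolding a_def sum_distrib_right
        by (intro sum.cong refl) (auto simp: diag_pairs_def)
      also have "\<dots> = (\<Sum>\<mu>\<in>?I. \<Sum>\<nu>\<in>?I. (X \<mu> \<nu> - Y \<mu> \<nu>) * chr (\<nu> - \<mu>) u)"
        by (simp add: sum_by_differences[OF fin])
      also have "\<dots> = 0"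
        using eq[of u] card by (simp add: qform_E_vec left_diff_distrib sum_subtractf)
      finally show ?thesis .
    qed
    then have "a (\<nu>\<^sub>0 - \<mu>\<^sub>0) = 0"
      by (rule chr_independent[rotated]) (use True fin in \<open>auto intro: rev_image_eqI\<close>)
    moreover have "a (\<nu>\<^sub>0 - \<mu>\<^sub>0) =
        (\<Sum>(\<mu>, \<nu>)\<in>diag_pairs ?I (\<nu>\<^sub>0 - \<mu>\<^sub>0). X \<mu>\<^sub>0 \<nu>\<^sub>0 - Y \<mu>\<^sub>0 \<nu>\<^sub>0)"
      unfolding a_def
    proof (intro sum.cong refl, clarify)
      fix \<mu> \<nu> assume "(\<mu>, \<nu>) \<in> diag_pairs ?I (\<nu>\<^sub>0 - \<mu>\<^sub>0)"
      then have "\<mu> \<in> ?I" "\<nu> \<in> ?I" "\<mu> - \<nu> = \<mu>\<^sub>0 - \<nu>\<^sub>0"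
        by (auto simp: diag_pairs_def algebra_simps)
      then have "X \<mu> \<nu> = X \<mu>\<^sub>0 \<nu>\<^sub>0" "Y \<mu> \<nu> = Y \<mu>\<^sub>0 \<nu>\<^sub>0"
        using Toep_diagonal[OF XY(1)] Toep_diagonal[OF XY(2)] True by blast+
      then show "X \<mu> \<nu> - Y \<mu> \<nu> = X \<mu>\<^sub>0 \<nu>\<^sub>0 - Y \<mu>\<^sub>0 \<nu>\<^sub>0"
        by simp
    qed
    moreover have "card (diag_pairs ?I (\<nu>\<^sub>0 - \<mu>\<^sub>0)) \<noteq> 0"
      using True finite_diag_pairs[OF fin] by (auto simp: diag_pairs_def)
    ultimately show ?thesis
      by (simp add: case_prod_unfold)
  next
    case False
    then show ?thesis
      using XY by (auto simp: Toep_def)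
  qed
qed

text \<open>The coefficients of the polynomial, spread evenly over the diagonals: the entries on the
  diagonal \<open>\<delta>\<close> are \<open>c \<delta>\<close> divided by the length of that diagonal. The factor \<open>card I\<close> makes up
  for the normalisation of \<^const>\<open>E_vec\<close>. On \<open>I \<times> I\<close> the denominator is nonzero, because the
  pair \<open>(\<mu>, \<nu>)\<close> itself lies on its diagonal.\<close>

definition coeff_matrix :: "'a::ab_group_add set \<Rightarrow> ('a \<Rightarrow> complex) \<Rightarrow> 'a \<Rightarrow> 'a \<Rightarrow> complex" where
  "coeff_matrix I c = (\<lambda>\<mu> \<nu>. if \<mu> \<in> I \<and> \<nu> \<in> I
     then of_nat (card I) * c (\<nu> - \<mu>) / of_nat (card (diag_pairs I (\<nu> - \<mu>))) else 0)"

lemma coeff_matrix_in_Toep: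
  assumes poly: "trig_poly \<Omega> c f"
    and neg: "\<And>\<mu>. c \<mu> \<noteq> 0 \<Longrightarrow> - \<mu> \<in> \<Omega>"
  shows "coeff_matrix (Omega_d \<Omega> d) c \<in> Toep \<Omega> d"
proof -
  let ?I = "Omega_d \<Omega> d"
  have cnj: "cnj (c (- \<delta>)) = c \<delta>" for \<delta>
  proof (cases "\<delta> \<in> \<Omega>")
    case True
    then show ?thesis
      using poly by (metis trig_poly_def)
  next
    case False
    then have "c \<delta> = 0" "c (- \<delta>) = 0"
      using poly neg[of "- \<delta>"] unfolding trig_poly_def by auto
    then show ?thesis by simp
  qed
  show ?thesis
  proof (rule ToepI)
    show "coeff_matrix ?I c \<mu> \<nu> = 0" if "\<mu> \<notin> ?I \<or> \<nu> \<notin> ?I" for \<mu> \<nu>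
      using that by (auto simp: coeff_matrix_def)
    show "hermitian ?I (coeff_matrix ?I c)"
      unfolding hermitian_def
    proof (intro ballI)
      fix \<mu> \<nu> assume "\<mu> \<in> ?I" "\<nu> \<in> ?I"
      then show "coeff_matrix ?I c \<mu> \<nu> = cnj (coeff_matrix ?I c \<nu> \<mu>)"
        using cnj[of "\<nu> - \<mu>"] card_diag_pairs_uminus[of ?I "\<nu> - \<mu>"]
        by (simp add: coeff_matrix_def)
    qed
    show "coeff_matrix ?I c \<mu> \<nu> = coeff_matrix ?I c \<mu>' \<nu>'"
      if "\<mu> \<in> ?I" "\<nu> \<in> ?I" "\<mu>' \<in> ?I" "\<nu>' \<in> ?I" "\<mu> - \<nu> = \<mu>' - \<nu>'" for \<mu> \<nu> \<mu>' \<nu>'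
    proof -
      have "\<nu> - \<mu> = \<nu>' - \<mu>'"
        using that(5) by (metis minus_diff_eq)
      then show ?thesis
        using that(1-4) by (simp add: coeff_matrix_def)
    qed
  qed
qed

lemma qform_coeff_matrix:
  assumes fin: "finite (Omega_d \<Omega> d)" and ne: "Omega_d \<Omega> d \<noteq> {}" and poly: "trig_poly \<Omega> c f"
    and supp: "\<And>\<mu>. c \<mu> \<noteq> 0 \<Longrightarrow> \<exists>\<alpha>\<in>Omega_d \<Omega> d. \<exists>\<beta>\<in>Omega_d \<Omega> d. \<mu> = \<beta> - \<alpha>"
  shows "qform (Omega_d \<Omega> d) (coeff_matrix (Omega_d \<Omega> d) c) (E_vec \<Omega> d u) = complex_of_real (f u)"
proof -
  let ?I = "Omega_d \<Omega> d"
  let ?D = "(\<lambda>(\<mu>, \<nu>). \<nu> - \<mu>) ` (?I \<times> ?I)"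
  have card: "card ?I \<noteq> 0"
    using fin ne by auto
  have "(\<Sum>\<mu>\<in>?I. \<Sum>\<nu>\<in>?I. coeff_matrix ?I c \<mu> \<nu> * chr (\<nu> - \<mu>) u) =
      (\<Sum>\<delta>\<in>?D. \<Sum>(\<mu>, \<nu>)\<in>diag_pairs ?I \<delta>. coeff_matrix ?I c \<mu> \<nu> * chr (\<nu> - \<mu>) u)"
    by (rule sum_by_differences[OF fin])
  also have "\<dots> = (\<Sum>\<delta>\<in>?D. of_nat (card ?I) * (c \<delta> * chr \<delta> u))"
  proof (intro sum.cong refl)
    fix \<delta> assume "\<delta> \<in> ?D"
    then have "card (diag_pairs ?I \<delta>) \<noteq> 0"
      using finite_diag_pairs[OF fin] by (auto simp: diag_pairs_def)
    moreover have "(\<Sum>(\<mu>, \<nu>)\<in>diag_pairs ?I \<delta>. coeff_matrix ?I c \<mu> \<nu> * chr (\<nu> - \<mu>) u) =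
        (\<Sum>p\<in>diag_pairs ?I \<delta>.
          of_nat (card ?I) * c \<delta> / of_nat (card (diag_pairs ?I \<delta>)) * chr \<delta> u)"
      by (intro sum.cong refl) (auto simp: diag_pairs_def coeff_matrix_def)
    ultimately show "(\<Sum>(\<mu>, \<nu>)\<in>diag_pairs ?I \<delta>. coeff_matrix ?I c \<mu> \<nu> * chr (\<nu> - \<mu>) u) =
        of_nat (card ?I) * (c \<delta> * chr \<delta> u)"
      by simp
  qed
  also have "\<dots> = of_nat (card ?I) * (\<Sum>\<mu> | c \<mu> \<noteq> 0. c \<mu> * chr \<mu> u)"
    unfolding sum_distrib_left[symmetric] using fin supp
    by (intro arg_cong2[of _ _ _ _ "(*)"] refl sum.mono_neutral_right) fastforce+
  finally show ?thesis
    using poly card by (simp add: qform_E_vec trig_poly_def)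
qed

text \<open>As \<^const>\<open>Omega_d\<close> is closed under negation, sums of two of its elements are also differences
  of two of its elements, and a Toeplitz matrix has a diagonal for each of them.\<close>

lemma mat_of_eq_coeff_matrix:
  assumes lattice: "full_lattice \<Omega>" and poly: "trig_poly \<Omega> c f"
    and supp: "\<forall>\<mu>. c \<mu> \<noteq> 0 \<longrightarrow> (\<exists>\<alpha>\<in>Omega_d \<Omega> d. \<exists>\<beta>\<in>Omega_d \<Omega> d. \<mu> = \<alpha> + \<beta>)"
  shows "mat_of \<Omega> d f = coeff_matrix (Omega_d \<Omega> d) c"
proof -
  let ?I = "Omega_d \<Omega> d"
  note fin = finite_Omega_d[OF lattice, of d]
  have supp': "\<exists>\<alpha>\<in>?I. \<exists>\<beta>\<in>?I. \<mu> = \<beta> - \<alpha>" if nz: "c \<mu> \<noteq> 0" for \<mu>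
  proof -
    obtain \<alpha> \<beta> where "\<alpha> \<in> ?I" "\<beta> \<in> ?I" "\<mu> = \<alpha> + \<beta>"
      using supp nz by blast
    moreover from this have "\<mu> = \<beta> - (- \<alpha>)"
      by simp
    ultimately show ?thesis
      using uminus_Omega_d[OF lattice] by blast
  qed
  have "- \<mu> \<in> \<Omega>" if "c \<mu> \<noteq> 0" for \<mu>
    using poly that uminus_lattice[OF lattice] by (auto simp: trig_poly_def)
  then have T: "coeff_matrix ?I c \<in> Toep \<Omega> d"
    by (rule coeff_matrix_in_Toep[OF poly])
  have q: "qform ?I (coeff_matrix ?I c) (E_vec \<Omega> d u) = complex_of_real (f u)" for u
    using qform_coeff_matrix[OF fin _ poly supp'] zero_in_Omega_d[OF lattice, of d] by blast
  show ?thesis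
    unfolding mat_of_def
  proof (rule the_equality)
    fix X assume "X \<in> Toep \<Omega> d \<and> (\<forall>u. complex_of_real (f u) = qform ?I X (E_vec \<Omega> d u))"
    then show "X = coeff_matrix ?I c"
      using q by (intro Toep_unique[OF fin _ T]) auto
  qed (simp add: T q)
qed

lemma mat_of_invariant:
  fixes W :: "('a::real_inner \<Rightarrow> 'a) set"
  assumes lattice: "full_lattice \<Omega>" and poly: "trig_poly \<Omega> c f"
    and supp: "\<forall>\<mu>. c \<mu> \<noteq> 0 \<longrightarrow> (\<exists>\<alpha>\<in>Omega_d \<Omega> d. \<exists>\<beta>\<in>Omega_d \<Omega> d. \<mu> = \<alpha> + \<beta>)"
    and inv: "tp_invariant W c f"
    and s: "s \<in> W" "linear s" "bij s" "s ` Omega_d \<Omega> d = Omega_d \<Omega> d"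
  shows "mat_of \<Omega> d f (s \<mu>) (s \<nu>) = mat_of \<Omega> d f \<mu> \<nu>"
proof -
  have "s \<mu> \<in> Omega_d \<Omega> d \<longleftrightarrow> \<mu> \<in> Omega_d \<Omega> d" for \<mu>
    using s(3,4) by (metis bij_is_inj inj_image_mem_iff)
  moreover have "s \<nu> - s \<mu> = s (\<nu> - \<mu>)"
    by (simp add: linear_diff[OF s(2)])
  moreover have "c (s (\<nu> - \<mu>)) = c (\<nu> - \<mu>)"
    using invariant_coefficients[OF poly inv s(1,3), of "s (\<nu> - \<mu>)"] s(3)
    by (simp add: bij_is_inj)
  ultimately show ?thesis
    by (simp add: mat_of_eq_coeff_matrix[OF lattice poly supp] coeff_matrix_def
        card_diag_pairs_linear[OF s(2-4)])
qed

section \<open>Averaging over the group\<close>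

lemma sum_permuted:
  assumes "bij s" "s ` I = I"
  shows "(\<Sum>\<mu>\<in>I. g (s \<mu>)) = (\<Sum>\<mu>\<in>I. g \<mu>)"
proof (rule sum.reindex_bij_betw)
  show "bij_betw s I I"
    using bij_betw_subset[OF assms(1) subset_UNIV assms(2)] .
qed

lemma inv_bij [simp]:
  assumes "bij s"
  shows "inv s (s x) = x" "s (inv s x) = x"
  using assms by (auto simp: bij_is_inj bij_is_surj surj_f_inv_f)

lemma inv_image_eq:
  assumes "bij s" "s ` I = I"
  shows "inv s \<mu> \<in> I \<longleftrightarrow> \<mu> \<in> I"
  using assms by (metis bij_is_inj inj_image_mem_iff inv_bij(2))

lemma tr_star_act:
  assumes "bij s" "s ` I = I"
  shows "tr I (star_act s X) = tr I X"
  using sum_permuted[OF assms, of "\<lambda>\<mu>. X (inv s \<mu>) (inv s \<mu>)"] assms(1)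
  by (simp add: tr_def star_act_def)

lemma qform_star_act:
  assumes "bij s" "s ` I = I"
  shows "qform I (star_act s X) x = qform I X (x \<circ> s)"
proof -
  have "qform I (star_act s X) x =
      (\<Sum>\<mu>\<in>I. \<Sum>\<nu>\<in>I. cnj (x (s \<mu>)) * X (inv s (s \<mu>)) (inv s (s \<nu>)) * x (s \<nu>))"
    unfolding qform_def star_act_def
    by (rule trans[OF sum_permuted[OF assms, symmetric]])
      (rule sum.cong[OF refl], rule sum_permuted[OF assms, symmetric])
  then show ?thesis
    using assms(1) by (simp add: qform_def)
qed

lemma tr_mmul_star_act:
  assumes "bij s" "s ` I = I" and M: "\<And>\<mu> \<nu>. M (s \<mu>) (s \<nu>) = M \<mu> \<nu>"
  shows "tr I (mmul I M (star_act s X)) = tr I (mmul I M X)"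
proof -
  have "tr I (mmul I M (star_act s X)) =
      (\<Sum>\<mu>\<in>I. \<Sum>\<nu>\<in>I. M (s \<mu>) (s \<nu>) * X (inv s (s \<nu>)) (inv s (s \<mu>)))"
    unfolding tr_def mmul_def star_act_def
    by (rule trans[OF sum_permuted[OF assms(1,2), symmetric]])
      (rule sum.cong[OF refl], rule sum_permuted[OF assms(1,2), symmetric])
  then show ?thesis
    using assms(1) by (simp add: tr_def mmul_def M)
qed

lemma star_act_in_Toep:
  assumes X: "X \<in> Toep \<Omega> d"
    and s: "linear s" "bij s" "s ` Omega_d \<Omega> d = Omega_d \<Omega> d"
  shows "star_act s X \<in> Toep \<Omega> d"
proof (rule ToepI)
  note mem = inv_image_eq[OF s(2,3)]
  show "star_act s X \<mu> \<nu> = 0" if "\<mu> \<notin> Omega_d \<Omega> d \<or> \<nu> \<notin> Omega_d \<Omega> d" for \<mu> \<nu>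
    using Toep_outside[OF X] that mem unfolding star_act_def by blast
  show "hermitian (Omega_d \<Omega> d) (star_act s X)"
    using Toep_hermitian[OF X] mem unfolding hermitian_def star_act_def by blast
  show "star_act s X \<mu> \<nu> = star_act s X \<mu>' \<nu>'"
    if "\<mu> \<in> Omega_d \<Omega> d" "\<nu> \<in> Omega_d \<Omega> d" "\<mu>' \<in> Omega_d \<Omega> d" "\<nu>' \<in> Omega_d \<Omega> d"
      "\<mu> - \<nu> = \<mu>' - \<nu>'" for \<mu> \<nu> \<mu>' \<nu>'
  proof -
    have "s (inv s \<mu> - inv s \<nu>) = s (inv s \<mu>' - inv s \<nu>')"
      using that(5) s(2) by (simp add: linear_diff[OF s(1)])
    then have "inv s \<mu> - inv s \<nu> = inv s \<mu>' - inv s \<nu>'"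
      using s(2) by (metis bij_is_inj injD)
    then show ?thesis
      unfolding star_act_def using that mem by (intro Toep_diagonal[OF X]) auto
  qed
qed

text \<open>The Reynolds operator of the action on matrices: the mean of the translates of \<open>X\<close>.\<close>

definition avg :: "('a \<Rightarrow> 'a) set \<Rightarrow> ('a \<Rightarrow> 'a \<Rightarrow> complex) \<Rightarrow> 'a \<Rightarrow> 'a \<Rightarrow> complex" where
  "avg W X = (\<lambda>\<mu> \<nu>. (\<Sum>s\<in>W. star_act s X \<mu> \<nu>) / of_nat (card W))"

lemma avg_in_Toep:
  assumes "\<And>s. s \<in> W \<Longrightarrow> star_act s X \<in> Toep \<Omega> d"
  shows "avg W X \<in> Toep \<Omega> d"
proof (rule ToepI)
  show "avg W X \<mu> \<nu> = 0" if "\<mu> \<notin> Omega_d \<Omega> d \<or> \<nu> \<notin> Omega_d \<Omega> d" for \<mu> \<nu>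
  proof -
    have "star_act s X \<mu> \<nu> = 0" if "s \<in> W" for s
      using Toep_outside[OF assms[OF that]] \<open>_ \<or> _\<close> by blast
    then show ?thesis
      by (simp add: avg_def)
  qed
  show "hermitian (Omega_d \<Omega> d) (avg W X)"
    unfolding hermitian_def
  proof (intro ballI)
    fix \<mu> \<nu> assume "\<mu> \<in> Omega_d \<Omega> d" "\<nu> \<in> Omega_d \<Omega> d"
    then have "star_act s X \<mu> \<nu> = cnj (star_act s X \<nu> \<mu>)" if "s \<in> W" for s
      using Toep_hermitian[OF assms[OF that]] unfolding hermitian_def by blast
    then show "avg W X \<mu> \<nu> = cnj (avg W X \<nu> \<mu>)"
      by (simp add: avg_def cong: sum.cong)
  qed
  show "avg W X \<mu> \<nu> = avg W X \<mu>' \<nu>'"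
    if "\<mu> \<in> Omega_d \<Omega> d" "\<nu> \<in> Omega_d \<Omega> d" "\<mu>' \<in> Omega_d \<Omega> d" "\<nu>' \<in> Omega_d \<Omega> d"
      "\<mu> - \<nu> = \<mu>' - \<nu>'" for \<mu> \<nu> \<mu>' \<nu>'
    unfolding avg_def
    using Toep_diagonal[OF assms that] by (intro arg_cong2[of _ _ _ _ "(/)"] sum.cong refl)
qed

lemma star_act_avg:
  assumes group: "finite_linear_group W" and t: "t \<in> W"
  shows "star_act t (avg W X) = avg W X"
proof -
  have bij: "bij s" if "s \<in> W" for s
    using group that by (simp add: finite_linear_group_def)
  have comp: "star_act t (star_act s X) = star_act (t \<circ> s) X" if "s \<in> W" for s
    by (simp add: star_act_def o_inv_distrib bij t that)
  have shift: "bij_betw ((\<circ>) t) W W"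
  proof (rule bij_betwI[where g = "(\<circ>) (inv t)"])
    show "(\<circ>) t \<in> W \<rightarrow> W" "(\<circ>) (inv t) \<in> W \<rightarrow> W"
      using group t by (auto simp: finite_linear_group_def)
  qed (use bij[OF t] in \<open>auto simp: fun_eq_iff\<close>)
  have "star_act t (avg W X) \<mu> \<nu> = avg W X \<mu> \<nu>" for \<mu> \<nu>
  proof -
    have "(\<Sum>s\<in>W. star_act t (star_act s X) \<mu> \<nu>) = (\<Sum>s\<in>W. star_act (t \<circ> s) X \<mu> \<nu>)"
      by (simp add: comp)
    also have "\<dots> = (\<Sum>s\<in>W. star_act s X \<mu> \<nu>)"
      by (rule sum.reindex_bij_betw[OF shift])
    finally show ?thesis
      by (simp add: avg_def star_act_def)
  qed
  then show ?thesis
    by (intro ext)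
qed

lemma tr_avg: "tr I (avg W X) = (\<Sum>s\<in>W. tr I (star_act s X)) / of_nat (card W)"
  unfolding tr_def avg_def sum_divide_distrib[symmetric] by (subst sum.swap) simp

lemma qform_avg: "qform I (avg W X) x = (\<Sum>s\<in>W. qform I (star_act s X) x) / of_nat (card W)"
proof -
  have "qform I (avg W X) x =
      (\<Sum>\<mu>\<in>I. \<Sum>\<nu>\<in>I. \<Sum>s\<in>W. cnj (x \<mu>) * star_act s X \<mu> \<nu> * x \<nu> / of_nat (card W))"
    by (simp add: qform_def avg_def sum_divide_distrib sum_distrib_left sum_distrib_right)
  also have "\<dots> = (\<Sum>s\<in>W. \<Sum>\<mu>\<in>I. \<Sum>\<nu>\<in>I. cnj (x \<mu>) * star_act s X \<mu> \<nu> * x \<nu> / of_nat (card W))"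
    by (simp only: sum.swap[of _ W I])
  finally show ?thesis
    by (simp add: qform_def sum_divide_distrib)
qed

lemma mmul_avg: "mmul I M (avg W X) = (\<lambda>\<mu> \<nu>. (\<Sum>s\<in>W. mmul I M (star_act s X) \<mu> \<nu>) / of_nat (card W))"
  unfolding mmul_def avg_def sum_divide_distrib sum_distrib_left
  by (intro ext, subst sum.swap) simp

lemma tr_mmul_avg:
  "tr I (mmul I M (avg W X)) = (\<Sum>s\<in>W. tr I (mmul I M (star_act s X))) / of_nat (card W)"
  unfolding tr_def mmul_avg sum_divide_distrib[symmetric] by (subst sum.swap) simp

text \<open>Averaging maps feasible points to invariant feasible points and, for an invariant cost
  matrix, preserves the objective.\<close>

lemma vals_eq_vals_inv:
  fixes W :: "('a::real_inner \<Rightarrow> 'a) set"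
  assumes group: "finite_linear_group W"
    and I: "\<forall>s\<in>W. s ` Omega_d \<Omega> d = Omega_d \<Omega> d"
    and M: "\<And>s \<mu> \<nu>. s \<in> W \<Longrightarrow> mat_of \<Omega> d f (s \<mu>) (s \<nu>) = mat_of \<Omega> d f \<mu> \<nu>"
  shows "vals \<Omega> d f = vals_inv \<Omega> d W f"
proof
  show "vals_inv \<Omega> d W f \<subseteq> vals \<Omega> d f"
    by (auto simp: vals_def vals_inv_def Toep_inv_def)
  let ?I = "Omega_d \<Omega> d"
  have card: "card W \<noteq> 0"
    using group by (auto simp: finite_linear_group_def)
  have s: "linear s" "bij s" "s ` ?I = ?I" if "s \<in> W" for s
    using group I that by (auto simp: finite_linear_group_def)
  show "vals \<Omega> d f \<subseteq> vals_inv \<Omega> d W f"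
  proof
    fix r assume "r \<in> vals \<Omega> d f"
    then obtain X where X: "X \<in> Toep \<Omega> d" "psd ?I X" "tr ?I X = 1"
      and r: "r = Re (tr ?I (mmul ?I (mat_of \<Omega> d f) X))"
      by (auto simp: vals_def)
    have Toep: "avg W X \<in> Toep \<Omega> d"
      by (intro avg_in_Toep star_act_in_Toep X(1) s)
    then have "avg W X \<in> Toep_inv \<Omega> d W"
      using star_act_avg[OF group] by (simp add: Toep_inv_def)
    moreover have "psd ?I (avg W X)"
      unfolding psd_def
    proof (intro conjI allI)
      show "hermitian ?I (avg W X)"
        using Toep by (rule Toep_hermitian)
      show "0 \<le> Re (qform ?I (avg W X) x)" for x
        using X(2) by (simp add: qform_avg qform_star_act[OF s(2,3)] psd_def sum_nonneg)
    qed
    moreover have "tr ?I (avg W X) = 1"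
      using X(3) card by (simp add: tr_avg tr_star_act[OF s(2,3)])
    moreover have "r = Re (tr ?I (mmul ?I (mat_of \<Omega> d f) (avg W X)))"
      using r card by (simp add: tr_mmul_avg tr_mmul_star_act[OF s(2,3) M])
    ultimately show "r \<in> vals_inv \<Omega> d W f"
      by (auto simp: vals_inv_def)
  qed
qed

section \<open>Passage to the diagonal blocks\<close>

lemma mmul_assoc: "mmul K (mmul L A B) C = mmul L A (mmul K B C)"
  unfolding mmul_def sum_distrib_left sum_distrib_right
  by (intro ext, subst sum.swap) (simp add: mult.assoc)

lemma tr_mmul_commute: "tr I (mmul J A B) = tr J (mmul I B A)"
  unfolding tr_def mmul_def by (subst sum.swap) (simp add: mult.commute)

lemma mmul_left_identity:
  assumes "finite I" "i \<in> I" "\<And>i'. i' \<in> I \<Longrightarrow> P i i' = (if i = i' then 1 else 0)"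
  shows "mmul I P A i k = A i k"
proof -
  have "mmul I P A i k = (\<Sum>i'\<in>I. if i = i' then A i' k else 0)"
    unfolding mmul_def using assms(3) by (intro sum.cong) auto
  then show ?thesis
    using assms(1,2) by simp
qed

lemma mmul_cong_right: "(\<And>k. k \<in> K \<Longrightarrow> B k j = B' k j) \<Longrightarrow> mmul K A B i j = mmul K A B' i j"
  by (simp add: mmul_def)

lemma tr_cong: "(\<And>i. i \<in> I \<Longrightarrow> A i i = B i i) \<Longrightarrow> tr I A = tr I B"
  by (simp add: tr_def)

lemma tr_unitary_conjugate:
  assumes fin: "finite I" and T: "unitary I J T"
  shows "tr J (mmul J (mmul I (mmul I (adj T) A) T) (mmul I (mmul I (adj T) X) T)) = tr I (mmul I A X)"
proof -
  define P where "P = mmul J T (adj T)"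
  have P: "mmul I P B i k = B i k" if "i \<in> I" for B :: "'a \<Rightarrow> 'c \<Rightarrow> complex" and i k
    by (rule mmul_left_identity) (use fin that T in \<open>auto simp: unitary_def P_def\<close>)
  have P': "mmul I P B i k = B i k" if "i \<in> I" for B :: "'a \<Rightarrow> 'b \<Rightarrow> complex" and i k
    by (rule mmul_left_identity) (use fin that T in \<open>auto simp: unitary_def P_def\<close>)
  have "tr J (mmul J (mmul I (mmul I (adj T) A) T) (mmul I (mmul I (adj T) X) T)) =
      tr J (mmul I (adj T) (mmul I A (mmul I P (mmul I X T))))"
    by (simp add: mmul_assoc P_def)
  also have "\<dots> = tr J (mmul I (adj T) (mmul I A (mmul I X T)))"
    by (intro tr_cong mmul_cong_right P')
  also have "\<dots> = tr J (mmul I (mmul I (adj T) (mmul I A X)) T)"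
    by (simp add: mmul_assoc)
  also have "\<dots> = tr I (mmul I P (mmul I A X))"
    by (subst tr_mmul_commute) (simp add: mmul_assoc P_def)
  also have "\<dots> = tr I (mmul I A X)"
    by (intro tr_cong P)
  finally show ?thesis .
qed

lemma qform_eq_mmul: "qform I A x = mmul I (mmul I (\<lambda>_ i. cnj (x i)) A) (\<lambda>i _. x i) () ()"
  unfolding qform_def mmul_def sum_distrib_right by (subst sum.swap) simp

lemma qform_conjugate:
  "qform J (mmul I (mmul I (adj T) X) T) y = qform I X (\<lambda>i. \<Sum>j\<in>J. T i j * y j)"
proof -
  have 1: "(\<lambda>i (_::unit). \<Sum>j\<in>J. T i j * y j) = mmul J T (\<lambda>j _. y j)"
    by (simp add: mmul_def)
  have 2: "(\<lambda>(_::unit) i. cnj (\<Sum>j\<in>J. T i j * y j)) = mmul J (\<lambda>_ j. cnj (y j)) (adj T)"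
    by (simp add: mmul_def adj_def mult.commute)
  show ?thesis
    unfolding qform_eq_mmul 1 2 mmul_assoc ..
qed

lemma qform_cong: "(\<And>i. i \<in> I \<Longrightarrow> x i = y i) \<Longrightarrow> qform I A x = qform I A y"
  by (simp add: qform_def)

lemma hermitian_conjugate:
  assumes "hermitian I X"
  shows "mmul I (mmul I (adj T) X) T p q = cnj (mmul I (mmul I (adj T) X) T q p)"
proof -
  have herm: "cnj (X i' i) = X i i'" if "i \<in> I" "i' \<in> I" for i i'
  proof -
    have "X i i' = cnj (X i' i)"
      using assms that unfolding hermitian_def by blast
    then show ?thesis ..
  qed
  have "cnj (mmul I (mmul I (adj T) X) T q p) =
      (\<Sum>i\<in>I. \<Sum>i'\<in>I. T i' q * cnj (X i' i) * cnj (T i p))"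
    by (simp add: mmul_def adj_def sum_distrib_right)
  also have "\<dots> = (\<Sum>i\<in>I. \<Sum>i'\<in>I. T i' q * X i i' * cnj (T i p))"
    by (intro sum.cong refl) (simp add: herm)
  also have "\<dots> = mmul I (mmul I (adj T) X) T p q"
    unfolding mmul_def adj_def sum_distrib_right
    by (subst sum.swap) (simp add: mult_ac)
  finally show ?thesis ..
qed

lemma psd_conjugate:
  assumes "psd I X"
  shows "psd J (mmul I (mmul I (adj T) X) T)"
  unfolding psd_def
proof (intro conjI allI)
  show "hermitian J (mmul I (mmul I (adj T) X) T)"
    unfolding hermitian_def using assms
    by (intro ballI hermitian_conjugate) (simp add: psd_def)
  show "0 \<le> Re (qform J (mmul I (mmul I (adj T) X) T) y)" for y
    unfolding qform_conjugate using assms by (simp add: psd_def)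
qed

lemma qform_unitary:
  assumes "finite I" "unitary I J T"
  shows "qform I X x = qform J (mmul I (mmul I (adj T) X) T) (\<lambda>j. \<Sum>i\<in>I. cnj (T i j) * x i)"
  unfolding qform_conjugate
proof (rule qform_cong)
  fix i assume "i \<in> I"
  have "x i = mmul I (mmul J T (adj T)) (\<lambda>i _. x i) i ()"
    by (rule mmul_left_identity[symmetric])
      (use assms \<open>i \<in> I\<close> in \<open>auto simp: unitary_def\<close>)
  also have "\<dots> = (\<Sum>j\<in>J. T i j * (\<Sum>i\<in>I. cnj (T i j) * x i))"
    unfolding mmul_assoc by (simp add: mmul_def adj_def)
  finally show "x i = (\<Sum>j\<in>J. T i j * (\<Sum>i\<in>I. cnj (T i j) * x i))" .
qed

lemma sum_col_index:
  "(\<Sum>p\<in>col_index h m dd. g p) = (\<Sum>i=1..h. \<Sum>k=1..dd i. \<Sum>j=1..m i. g (i, k, j))"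
  unfolding col_index_def by (simp add: sum.Sigma split_def)

text \<open>A double sum over the column indices in which only the terms inside the small diagonal
  blocks contribute.\<close>

lemma sum_col_index_blocks:
  fixes g :: "nat \<times> nat \<times> nat \<Rightarrow> nat \<times> nat \<times> nat \<Rightarrow> complex"
  assumes "\<And>i k j i' k' j'. (i, k, j) \<in> col_index h m dd \<Longrightarrow> (i', k', j') \<in> col_index h m dd \<Longrightarrow>
      g (i, k, j) (i', k', j') = (if i = i' \<and> k = k' then b i k j j' else 0)"
  shows "(\<Sum>p\<in>col_index h m dd. \<Sum>q\<in>col_index h m dd. g p q) =
    (\<Sum>i=1..h. \<Sum>k=1..dd i. \<Sum>j=1..m i. \<Sum>j'=1..m i. b i k j j')"
  unfolding sum_col_index
proof (rule sum.cong[OF refl], rule sum.cong[OF refl], rule sum.cong[OF refl])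
  fix i k j assume ik: "i \<in> {1..h}" "k \<in> {1..dd i}" "j \<in> {1..m i}"
  have "(\<Sum>i'=1..h. \<Sum>k'=1..dd i'. \<Sum>j'=1..m i'. g (i, k, j) (i', k', j')) =
      (\<Sum>i'=1..h. \<Sum>k'=1..dd i'. if i' = i \<and> k' = k then \<Sum>j'=1..m i. b i k j j' else 0)"
    using ik by (intro sum.cong refl) (auto simp: assms col_index_def)
  also have "\<dots> = (\<Sum>i'=1..h. if i' = i then \<Sum>j'=1..m i. b i k j j' else 0)"
    using ik by (intro sum.cong refl) auto
  also have "\<dots> = (\<Sum>j'=1..m i. b i k j j')"
    using ik by simp
  finally show "(\<Sum>i'=1..h. \<Sum>k'=1..dd i'. \<Sum>j'=1..m i'. g (i, k, j) (i', k', j')) =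
      (\<Sum>j'=1..m i. b i k j j')" .
qed

lemma has_blocksD:
  assumes "has_blocks I h m dd T X B" "(i, k, j) \<in> col_index h m dd" "(i', k', j') \<in> col_index h m dd"
  shows "mmul I (mmul I (adj T) X) T (i, k, j) (i', k', j') = (if i = i' \<and> k = k' then B i j j' else 0)"
  using assms unfolding has_blocks_def by fastforce

lemma qform_blocks:
  assumes "has_blocks I h m dd T X B"
  shows "qform (col_index h m dd) (mmul I (mmul I (adj T) X) T) y =
    (\<Sum>i=1..h. \<Sum>k=1..dd i. qform {1..m i} (B i) (\<lambda>j. y (i, k, j)))"
  unfolding qform_def by (rule sum_col_index_blocks) (simp add: has_blocksD[OF assms])

lemma tr_mmul_blocks:
  assumes "has_blocks I h m dd T A F" "has_blocks I h m dd T X B"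
  shows "tr (col_index h m dd) (mmul (col_index h m dd)
      (mmul I (mmul I (adj T) A) T) (mmul I (mmul I (adj T) X) T)) =
    (\<Sum>i=1..h. of_nat (dd i) * tr {1..m i} (mmul {1..m i} (F i) (B i)))"
proof -
  have "tr (col_index h m dd) (mmul (col_index h m dd)
      (mmul I (mmul I (adj T) A) T) (mmul I (mmul I (adj T) X) T)) =
    (\<Sum>i=1..h. \<Sum>k=1..dd i. \<Sum>j=1..m i. \<Sum>j'=1..m i. F i j j' * B i j' j)"
    unfolding tr_def mmul_def[of "col_index h m dd"]
    by (rule sum_col_index_blocks) (auto simp: has_blocksD[OF assms(1)] has_blocksD[OF assms(2)])
  then show ?thesis
    by (simp add: tr_def mmul_def)
qed

text \<open>A block \<open>B i\<close> with \<open>dd i = 0\<close> would not occur in the conjugated matrix at all, and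
  its positive semidefiniteness would not follow from that of the matrix. Simple modules are
  nonzero, which rules this out.\<close>

lemma adapted_dim_pos:
  assumes "isotypic_decomposition I W h m dd V" "adapted_basis h m dd V T" "i \<in> {1..h}"
  shows "1 \<le> dd i"
proof (rule ccontr)
  assume "\<not> 1 \<le> dd i"
  moreover have "1 \<in> {1..m i}"
    using assms(1,3) by (auto simp: isotypic_decomposition_def)
  ultimately have "V i 1 = cvec.span {}"
    using assms(2,3) unfolding adapted_basis_def by fastforce
  moreover have "simple_submodule I W (V i 1)"
    using assms(1)[unfolded isotypic_decomposition_def, THEN conjunct2, THEN conjunct1]
      assms(3) \<open>1 \<in> {1..m i}\<close> by blast
  then have "V i 1 \<noteq> {0}"
    unfolding simple_submodule_def by blast
  ultimately show False
    by simp
qed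

text \<open>In the coordinates given by \<open>T\<close>, the quadratic form of \<open>X\<close> is the sum over \<open>i\<close> and \<open>k\<close> of the forms of the blocks
  \<open>B i\<close> in independent sets of variables.\<close>

lemma psd_iff_blocks_psd:
  assumes fin: "finite I" and T: "unitary I (col_index h m dd) T"
    and herm: "hermitian I X" and blocks: "has_blocks I h m dd T X B"
    and dd: "\<And>i. i \<in> {1..h} \<Longrightarrow> 1 \<le> dd i"
  shows "psd I X \<longleftrightarrow> (\<forall>i\<in>{1..h}. psd {1..m i} (B i))"
proof
  assume X: "psd I X"
  show "\<forall>i\<in>{1..h}. psd {1..m i} (B i)"
  proof
    fix i assume i: "i \<in> {1..h}"
    have entry: "B i j j' = mmul I (mmul I (adj T) X) T (i, 1, j) (i, 1, j')"
      if "j \<in> {1..m i}" "j' \<in> {1..m i}" for j j'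
      using has_blocksD[OF blocks, of i 1 j i 1 j'] i dd[OF i] that by (simp add: col_index_def)
    have "0 \<le> Re (qform {1..m i} (B i) x)" for x
    proof -
      \<comment> \<open>One of the \<open>dd i\<close> copies of \<open>B i\<close> suffices, here the one with \<open>k = 1\<close>.\<close>
      define y where "y = (\<lambda>(i', k, j). if i' = i \<and> k = (1::nat) then x j else 0)"
      have "qform (col_index h m dd) (mmul I (mmul I (adj T) X) T) y =
          (\<Sum>i'=1..h. \<Sum>k=1..dd i'. if i' = i \<and> k = 1 then qform {1..m i} (B i) x else 0)"
        unfolding qform_blocks[OF blocks]
        by (intro sum.cong refl) (auto simp: y_def qform_def)
      also have "\<dots> = (\<Sum>i'=1..h. if i' = i then qform {1..m i} (B i) x else 0)"
        using dd[OF i] by (intro sum.cong refl) auto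
      also have "\<dots> = qform {1..m i} (B i) x"
        using i by simp
      finally show ?thesis
        using psd_conjugate[OF X, of "col_index h m dd" T] unfolding psd_def by metis
    qed
    moreover have "hermitian {1..m i} (B i)"
      unfolding hermitian_def using entry hermitian_conjugate[OF herm] by metis
    ultimately show "psd {1..m i} (B i)"
      by (simp add: psd_def)
  qed
next
  assume "\<forall>i\<in>{1..h}. psd {1..m i} (B i)"
  then show "psd I X"
    using herm unfolding psd_def qform_unitary[OF fin T, of X] qform_blocks[OF blocks]
    by (auto intro!: sum_nonneg)
qed

lemma vals_inv_eq_vals_block:
  assumes fin: "finite (Omega_d \<Omega> d)"
    and decomp: "isotypic_decomposition (Omega_d \<Omega> d) W h m dd V"
    and T: "unitary (Omega_d \<Omega> d) (col_index h m dd) T" "adapted_basis h m dd V T"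
    and T_blocks: "\<forall>X\<in>Toep_inv \<Omega> d W. \<exists>B. has_blocks (Omega_d \<Omega> d) h m dd T X B"
    and F_blocks: "has_blocks (Omega_d \<Omega> d) h m dd T (mat_of \<Omega> d f) F"
  shows "vals_inv \<Omega> d W f = vals_block \<Omega> d W h m dd T F"
proof -
  let ?I = "Omega_d \<Omega> d"
  have psd: "psd ?I X \<longleftrightarrow> (\<forall>i\<in>{1..h}. psd {1..m i} (B i))"
    if "X \<in> Toep_inv \<Omega> d W" "has_blocks ?I h m dd T X B" for X B
    using that by (intro psd_iff_blocks_psd[OF fin T(1)] adapted_dim_pos[OF decomp T(2)])
      (auto simp: Toep_inv_def Toep_hermitian)
  have obj: "tr ?I (mmul ?I (mat_of \<Omega> d f) X) =
      (\<Sum>i=1..h. of_nat (dd i) * tr {1..m i} (mmul {1..m i} (F i) (B i)))"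
    if "has_blocks ?I h m dd T X B" for X B
    by (rule trans[OF tr_unitary_conjugate[OF fin T(1), symmetric]
          tr_mmul_blocks[OF F_blocks that]])
  show ?thesis
  proof (intro subset_antisym subsetI)
    fix r assume "r \<in> vals_inv \<Omega> d W f"
    then obtain X where X: "X \<in> Toep_inv \<Omega> d W" "psd ?I X" "tr ?I X = 1"
      and r: "r = Re (tr ?I (mmul ?I (mat_of \<Omega> d f) X))"
      by (auto simp: vals_inv_def)
    obtain B where B: "has_blocks ?I h m dd T X B"
      using T_blocks X(1) by blast
    show "r \<in> vals_block \<Omega> d W h m dd T F"
      unfolding vals_block_def mem_Collect_eq
      using X B psd[OF X(1) B] r[unfolded obj[OF B]] by (intro exI[of _ X] exI[of _ B] conjI) auto
  next
    fix r assume "r \<in> vals_block \<Omega> d W h m dd T F"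
    then obtain X B where X: "X \<in> Toep_inv \<Omega> d W" "tr ?I X = 1"
      and B: "has_blocks ?I h m dd T X B" "\<forall>i\<in>{1..h}. psd {1..m i} (B i)"
      and r: "r = Re (\<Sum>i=1..h. of_nat (dd i) * tr {1..m i} (mmul {1..m i} (F i) (B i)))"
      unfolding vals_block_def by blast
    show "r \<in> vals_inv \<Omega> d W f"
      unfolding vals_inv_def mem_Collect_eq
      using X psd[OF X(1) B(1)] B(2) r[folded obj[OF B(1)]] by (intro exI[of _ X] conjI) auto
  qed
qed

section \<open>Attainment of the minimum\<close>

text \<open>Tychonoff's theorem. Functions on arbitrary, possibly infinite, index types carry the product
  topology, so that the matrices need not be moved to a Euclidean space.\<close>

lemma compact_functions:
  fixes S :: "'i \<Rightarrow> 'b::topological_space set"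
  assumes "\<And>i. compact (S i)"
  shows "compact {x. \<forall>i. x i \<in> S i}"
proof -
  have "compactin (product_topology (\<lambda>_. euclidean) UNIV) (PiE UNIV S)"
    using assms by (simp add: compactin_PiE)
  then show ?thesis
    by (simp add: euclidean_product_topology PiE_UNIV_domain Pi_def)
qed

lemma continuous_on_entry [continuous_intros]:
  "continuous_on UNIV (\<lambda>X :: 'i \<Rightarrow> 'j \<Rightarrow> complex. X i j)"
  by (rule continuous_on_compose2[OF continuous_on_product_coordinates
        continuous_on_product_coordinates]) auto

lemma closed_Toep: "closed (Toep \<Omega> d)"
  unfolding Toep_def hermitian_def Ball_def Collect_conj_eq
  by (intro closed_Int closed_Collect_all closed_Collect_imp open_Collect_const
      closed_Collect_eq continuous_intros)

lemma closed_psd: "closed {X. psd I X}"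
  unfolding psd_def hermitian_def qform_def Ball_def Collect_conj_eq
  by (intro closed_Int closed_Collect_all closed_Collect_imp open_Collect_const
      closed_Collect_eq closed_Collect_le continuous_intros)

lemma closed_tr_eq: "closed {X. tr I X = a}"
  unfolding tr_def by (intro closed_Collect_eq continuous_intros)

text \<open>The diagonal entries are nonnegative with sum 1. Evaluating the quadratic form at vectors
  supported on two indices bounds the other entries by them.\<close>

lemma psd_entry_bound:
  assumes fin: "finite I" and X: "psd I X" "tr I X = 1" and ij: "i \<in> I" "j \<in> I"
  shows "norm (X i j) \<le> 1"
proof -
  have qf: "0 \<le> Re (qform I X x)" for x
    using X(1) by (simp add: psd_def)
  have herm: "X k l = cnj (X l k)" if "k \<in> I" "l \<in> I" for k l
    using X(1) that unfolding psd_def hermitian_def by blast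
  have supp: "qform I X x = (\<Sum>k\<in>K. \<Sum>l\<in>K. cnj (x k) * X k l * x l)"
    if "K \<subseteq> I" "\<And>k. k \<notin> K \<Longrightarrow> x k = 0" for K x
  proof -
    have "qform I X x = (\<Sum>k\<in>K. \<Sum>l\<in>I. cnj (x k) * X k l * x l)"
      unfolding qform_def using fin that by (intro sum.mono_neutral_right) auto
    also have "\<dots> = (\<Sum>k\<in>K. \<Sum>l\<in>K. cnj (x k) * X k l * x l)"
      using fin that by (intro sum.cong refl sum.mono_neutral_right) auto
    finally show ?thesis .
  qed
  have diag_nonneg: "0 \<le> Re (X k k)" if "k \<in> I" for k
    using qf[of "\<lambda>l. if l = k then 1 else 0"] that
    by (subst (asm) supp[of "{k}"]) auto
  have "(\<Sum>k\<in>I. Re (X k k)) = 1"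
    using X(2) by (simp add: tr_def flip: Re_sum)
  then have diag_le: "Re (X k k) \<le> 1" if "k \<in> I" for k
    using member_le_sum[of k I "\<lambda>k. Re (X k k)"] that fin diag_nonneg by auto
  show ?thesis
  proof (cases "i = j")
    case True
    have "X i i \<in> \<real>"
      using herm[OF ij(1) ij(1)] by (simp add: Reals_cnj_iff)
    then show ?thesis
      using True diag_le[OF ij(1)] diag_nonneg[OF ij(1)]
      by (metis abs_of_nonneg in_Reals_norm complex_is_Real_iff cmod_eq_Re)
  next
    case False
    show ?thesis
    proof (cases "X i j = 0")
      case nz: False
      \<comment> \<open>The phase makes the off-diagonal part of the quadratic form equal to \<open>- 2 \<bar>X i j\<bar>\<close>.\<close>
      define a where "a = - cnj (X i j) / of_real (norm (X i j))"
      have norm_sq: "X i j * cnj (X i j) = of_real (norm (X i j)) * of_real (norm (X i j))"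
        using complex_norm_square[of "X i j"] by (simp add: power2_eq_square)
      have aX: "a * X i j = - of_real (norm (X i j))"
        using nz norm_sq by (simp add: a_def mult.commute)
      have aa: "cnj a * a = 1"
        using nz norm_sq by (simp add: a_def)
      have "X j i = cnj (X i j)"
        by (rule herm[OF ij(2,1)])
      then have aX': "cnj a * X j i = - of_real (norm (X i j))"
        using arg_cong[OF aX, of cnj] by simp
      have "qform I X (\<lambda>k. if k = i then 1 else if k = j then a else 0) =
          X i i + a * X i j + cnj a * X j i + cnj a * a * X j j"
        using False ij by (subst supp[of "{i, j}"]) (auto simp: mult_ac)
      with qf[of "\<lambda>k. if k = i then 1 else if k = j then a else 0"]
      have "2 * norm (X i j) \<le> Re (X i i) + Re (X j j)"
        by (simp add: aX aX' aa)
      then show ?thesis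
        using diag_le[OF ij(1)] diag_le[OF ij(2)] by linarith
    qed simp
  qed
qed

lemma has_min_vals:
  assumes fin: "finite (Omega_d \<Omega> d)" and ne: "Omega_d \<Omega> d \<noteq> {}"
  shows "has_min (vals \<Omega> d f)"
proof -
  let ?I = "Omega_d \<Omega> d"
  define K where "K = {X \<in> Toep \<Omega> d. psd ?I X \<and> tr ?I X = 1}"
  define obj where "obj X = Re (tr ?I (mmul ?I (mat_of \<Omega> d f) X))" for X
  have box: "K \<subseteq> {X. \<forall>\<mu>. X \<mu> \<in> {y. \<forall>\<nu>. y \<nu> \<in> cball 0 1}}" (is "_ \<subseteq> ?B")
  proof
    fix X assume X: "X \<in> K"
    have "norm (X \<mu> \<nu>) \<le> 1" for \<mu> \<nu>
    proof (cases "\<mu> \<in> ?I \<and> \<nu> \<in> ?I")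
      case True
      then show ?thesis
        using X psd_entry_bound[OF fin] by (simp add: K_def)
    next
      case False
      then show ?thesis
        using X Toep_outside[of X \<Omega> d \<mu> \<nu>] by (simp add: K_def)
    qed
    then show "X \<in> ?B"
      by simp
  qed
  have "compact ?B"
    by (intro compact_functions compact_cball)
  moreover have "closed K"
  proof -
    have "K = Toep \<Omega> d \<inter> {X. psd ?I X} \<inter> {X. tr ?I X = 1}"
      unfolding K_def by blast
    then show ?thesis
      by (simp add: closed_Int closed_Toep closed_psd closed_tr_eq)
  qed
  ultimately have "compact (?B \<inter> K)"
    by (rule compact_Int_closed)
  then have "compact K"
    by (simp only: Int_absorb1[OF box])
  moreover have "K \<noteq> {}"
  proof -
    \<comment> \<open>The normalised identity matrix is feasible.\<close>
    define X where "X = (\<lambda>\<mu> \<nu>. if \<mu> \<in> ?I \<and> \<mu> = \<nu> then 1 / of_nat (card ?I) else 0 :: complex)"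
    have "X \<in> Toep \<Omega> d"
    proof (rule ToepI)
      show "X \<mu> \<nu> = 0" if "\<mu> \<notin> ?I \<or> \<nu> \<notin> ?I" for \<mu> \<nu>
        using that by (auto simp: X_def)
      show "hermitian ?I X"
        by (auto simp: hermitian_def X_def)
      show "X \<mu> \<nu> = X \<mu>' \<nu>'"
        if "\<mu> \<in> ?I" "\<nu> \<in> ?I" "\<mu>' \<in> ?I" "\<nu>' \<in> ?I" "\<mu> - \<nu> = \<mu>' - \<nu>'" for \<mu> \<nu> \<mu>' \<nu>'
        using that(1-4) arg_cong[OF that(5), of "\<lambda>x. x = 0"] by (simp add: X_def)
    qed
    moreover have "psd ?I X"
    proof -
      have "qform ?I X x = (\<Sum>\<mu>\<in>?I. of_real ((norm (x \<mu>))\<^sup>2 / real (card ?I)))" for x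
        unfolding qform_def
      proof (rule sum.cong[OF refl])
        fix \<mu> assume \<mu>: "\<mu> \<in> ?I"
        have "(\<Sum>\<nu>\<in>?I. cnj (x \<mu>) * X \<mu> \<nu> * x \<nu>) =
            (\<Sum>\<nu>\<in>?I. if \<nu> = \<mu> then cnj (x \<mu>) * x \<mu> / of_nat (card ?I) else 0)"
          using \<mu> by (intro sum.cong refl) (simp add: X_def)
        also have "\<dots> = of_real ((norm (x \<mu>))\<^sup>2 / real (card ?I))"
          using \<mu> fin by (simp add: complex_norm_square[unfolded of_real_power] mult.commute)
        finally show "(\<Sum>\<nu>\<in>?I. cnj (x \<mu>) * X \<mu> \<nu> * x \<nu>) =
            of_real ((norm (x \<mu>))\<^sup>2 / real (card ?I))" .
      qed
      moreover have "hermitian ?I X"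
        by (auto simp: hermitian_def X_def)
      ultimately show ?thesis
        by (simp add: psd_def sum_nonneg flip: of_real_sum)
    qed
    moreover have "tr ?I X = 1"
      using fin ne by (simp add: tr_def X_def)
    ultimately show ?thesis
      by (auto simp: K_def)
  qed
  moreover have "continuous_on K obj"
    unfolding obj_def tr_def mmul_def
    by (rule continuous_on_subset[OF _ subset_UNIV]) (intro continuous_intros)
  ultimately have "\<exists>X\<in>K. \<forall>Y\<in>K. obj X \<le> obj Y"
    by (rule continuous_attains_inf)
  moreover have "vals \<Omega> d f = obj ` K"
    unfolding vals_def K_def obj_def by blast
  ultimately show ?thesis
    by (simp add: has_min_def)
qed

section \<open>Equality of the three minima\<close>

theorem theorem3p3:
  fixes \<Omega> :: "'a::real_inner set" and W :: "('a \<Rightarrow> 'a) set"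
    and c :: "'a \<Rightarrow> complex" and f :: "'a \<Rightarrow> real" and d :: nat
    and h :: nat and m dd :: "nat \<Rightarrow> nat"
    and V :: "nat \<Rightarrow> nat \<Rightarrow> ('a \<Rightarrow> complex) set"
    and T :: "'a \<Rightarrow> nat \<times> nat \<times> nat \<Rightarrow> complex"
    and F :: "nat \<Rightarrow> nat \<Rightarrow> nat \<Rightarrow> complex"
  assumes lattice: "full_lattice \<Omega>"
    and group: "finite_linear_group W"
    and lattice_inv: "\<forall>s\<in>W. s ` \<Omega> = \<Omega>"
    and poly: "trig_poly \<Omega> c f"
    and poly_inv: "tp_invariant W c f"
    and supp: "\<forall>\<mu>. c \<mu> \<noteq> 0 \<longrightarrow> (\<exists>\<alpha>\<in>Omega_d \<Omega> d. \<exists>\<beta>\<in>Omega_d \<Omega> d. \<mu> = \<alpha> + \<beta>)"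
    and Omega_d_inv: "\<forall>s\<in>W. s ` Omega_d \<Omega> d = Omega_d \<Omega> d"
    and decomp: "isotypic_decomposition (Omega_d \<Omega> d) W h m dd V"
    and T_unitary: "unitary (Omega_d \<Omega> d) (col_index h m dd) T"
    and T_adapted: "adapted_basis h m dd V T"
    and T_blocks: "\<forall>X\<in>Toep_inv \<Omega> d W. \<exists>B. has_blocks (Omega_d \<Omega> d) h m dd T X B"
    and F_blocks: "has_blocks (Omega_d \<Omega> d) h m dd T (mat_of \<Omega> d f) F"
  shows "has_min (vals \<Omega> d f) \<and> has_min (vals_inv \<Omega> d W f) \<and>
    has_min (vals_block \<Omega> d W h m dd T F) \<and>
    f_d \<Omega> d f = f_d_inv \<Omega> d W f \<and> f_d_inv \<Omega> d W f = f_d_block \<Omega> d W h m dd T F"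
proof -
  note fin = finite_Omega_d[OF lattice, of d]
  have M: "mat_of \<Omega> d f (s \<mu>) (s \<nu>) = mat_of \<Omega> d f \<mu> \<nu>" if "s \<in> W" for s \<mu> \<nu>
    using mat_of_invariant[OF lattice poly supp poly_inv that] group Omega_d_inv that
    by (simp add: finite_linear_group_def)
  have "vals \<Omega> d f = vals_inv \<Omega> d W f"
    by (rule vals_eq_vals_inv[OF group Omega_d_inv M])
  moreover have "vals_inv \<Omega> d W f = vals_block \<Omega> d W h m dd T F"
    by (rule vals_inv_eq_vals_block[OF fin decomp T_unitary T_adapted T_blocks F_blocks])
  moreover have "has_min (vals \<Omega> d f)"
    using has_min_vals[OF fin] zero_in_Omega_d[OF lattice, of d] by blast
  ultimately show ?thesis
    by (simp add: f_d_def f_d_inv_def f_d_block_def)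
qed

end
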